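(* (1) There exists an Anosov structure on $\mathbb{R}^2$ whose underlying diffeomorphism is a linear hyperbolic automorphism of $\mathbb{R}^2$, but for which the stable and unstable foliations $\mathcal{F}^s,\mathcal{F}^u$ cannot both be mapped to the standard foliations for the linear hyperbolic map, i.e. there is no homeomorphism $h:\mathbb{R}^2\to\mathbb{R}^2$ that maps the leaves of $\mathcal{F}^s$ onto the vertical lines and the leaves of $\mathcal{F}^u$ onto the horizontal lines. (2) There exists an Anosov structure on $\mathbb{R}^2$ whose underlying diffeomorphism is topologically conjugate to the translation $(x,y)\mapsto(x+1,y)$ on $\mathbb{R}^2$, but whose stable foliation is not homeomorphic to the stable foliation $\mathcal{W}^s$ of White's example, i.e. there is no homeomorphism of $\mathbb{R}^2$ onto itself taking the leaves of the former onto the leaves of $\mathcal{W}^s$.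
   Context: An Anosov structure on $\mathbb{R}^2$ for a diffeomorphism $f:\mathbb{R}^2\to\mathbb{R}^2$ (the underlying diffeomorphism) consists of a complete Riemannian metric $\mu$ on $\mathbb{R}^2$ together with two continuous one-dimensional foliations $\mathcal{F}^s$ (stable) and $\mathcal{F}^u$ (unstable) of $\mathbb{R}^2$ with $C^1$ leaves, each respected by $f$ (the image under $f$ of a leaf of $\mathcal{F}^s$, resp. $\mathcal{F}^u$, is a leaf of $\mathcal{F}^s$, resp. $\mathcal{F}^u$), such that there exist constants $C>0$ and $\lambda>1$ for which, for every positive integer $n$, $\|Df^n(v)\|_\mu\ge C\lambda^n\|v\|_\mu$ for every vector $v$ tangent to a leaf of $\mathcal{F}^u$, and $\|Df^n(v)\|_\mu\le C\lambda^{-n}\|v\|_\mu$ for every vector $v$ tangent to a leaf of $\mathcal{F}^s$. Here $\|v\|_\mu$ is the length of $v$ in the metric $\mu$. A linear hyperbolic automorphism of $\mathbb{R}^2$ is an invertible linear map with one eigenvalue of modulus less than $1$ and one of modulus greater than $1$; the model is $T(x,y)=(2x,y/2)$, whose standard stable foliation is by vertical lines and whose standard unstable foliation is by horizontal lines. White's example is an Anosov structure for the translation $(x,y)\mapsto(x+2,y)$ built as follows. One takes a smooth field of Euclidean-orthonormal frames $(e_s(x,y),e_u(x,y))$ on $\mathbb{R}^2$, invariant under all vertical translations and under $(x,y)\mapsto(x+2,y)$, which rotates as the point moves horizontally, in such a way that there is a nontrivial interval of $x$-values on which $e_s$ is horizontal and another on which $e_u$ is horizontal. For $0<\lambda<1$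 the metric is $\langle u,v\rangle_\mu=\lambda^{2x}(u\cdot e_s)(v\cdot e_s)+\lambda^{-2x}(u\cdot e_u)(v\cdot e_u)$ at $(x,y)$. The stable foliation $\mathcal{W}^s$ is the foliation by integral curves of $e_s$ (and the unstable foliation is that by integral curves of $e_u$). Some leaves of $\mathcal{W}^s$ are vertical lines, while others are parabola-like: there are vertical lines $x=a$ and $x=b$, $a<b$, which are leaves of $\mathcal{W}^s$, such that the leaves in the strip $a<x<b$ are the vertical translates of the graph of a function $u:(a,b)\to\mathbb{R}$ tending to the same infinity ($+\infty$ at both ends, or $-\infty$ at both ends) as $x\to a^+$ and as $x\to b^-$. *)

theory Defs
  imports "HOL-Analysis.Analysis" "HOL-Library.Disjoint_Sets"
begin

type_synonym plane = "real \<times> real"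

text \<open>In finite dimension a map is of class C^(k+1) iff it is differentiable and all its
  directional derivatives are of class C^k.\<close>

fun Ck :: "nat \<Rightarrow> (plane \<Rightarrow> 'b::real_normed_vector) \<Rightarrow> bool" where
  "Ck 0 f \<longleftrightarrow> continuous_on UNIV f"
| "Ck (Suc k) f \<longleftrightarrow>
     (\<exists>f'. (\<forall>p. (f has_derivative f' p) (at p)) \<and> (\<forall>v. Ck k (\<lambda>p. f' p v)))"

definition smooth :: "(plane \<Rightarrow> 'b::real_normed_vector) \<Rightarrow> bool" where
  "smooth f \<longleftrightarrow> (\<forall>k. Ck k f)"

definition diffeomorphism :: "(plane \<Rightarrow> plane) \<Rightarrow> bool" where
  "diffeomorphism f \<longleftrightarrow> bij f \<and> smooth f \<and> smooth (inv f)"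

definition plane_homeo :: "(plane \<Rightarrow> plane) \<Rightarrow> bool" where
  "plane_homeo h \<longleftrightarrow> (\<exists>k. homeomorphism UNIV UNIV h k)"

definition topologically_conjugate :: "(plane \<Rightarrow> plane) \<Rightarrow> (plane \<Rightarrow> plane) \<Rightarrow> bool" where
  "topologically_conjugate f g \<longleftrightarrow> (\<exists>h. plane_homeo h \<and> h \<circ> f = g \<circ> h)"

definition riemannian_metric :: "(plane \<Rightarrow> plane \<Rightarrow> plane \<Rightarrow> real) \<Rightarrow> bool" where
  "riemannian_metric g \<longleftrightarrow>
     (\<forall>p. bilinear (g p) \<and> (\<forall>v w. g p v w = g p w v) \<and> (\<forall>v. v \<noteq> 0 \<longrightarrow> g p v v > 0)) \<and>
     (\<forall>v w. smooth (\<lambda>p. g p v w))"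

definition riem_norm :: "(plane \<Rightarrow> plane \<Rightarrow> plane \<Rightarrow> real) \<Rightarrow> plane \<Rightarrow> plane \<Rightarrow> real" where
  "riem_norm g p v = sqrt (g p v v)"

text \<open>The library's piecewise C^1 paths may have unbounded derivative near the exceptional
  parameters, and so infinite length, for which \<^const>\<open>integral\<close> would return 0.
  \<^const>\<open>has_integral\<close> restricts the infimum to the paths of finite length.\<close>

definition riem_dist :: "(plane \<Rightarrow> plane \<Rightarrow> plane \<Rightarrow> real) \<Rightarrow> plane \<Rightarrow> plane \<Rightarrow> real" where
  "riem_dist g p q = Inf {l. \<exists>\<gamma>. valid_path \<gamma> \<and> pathstart \<gamma> = p \<and> pathfinish \<gamma> = q \<and>
     ((\<lambda>t. riem_norm g (\<gamma> t) (vector_derivative \<gamma> (at t))) has_integral l) {0..1}}"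

definition riem_complete :: "(plane \<Rightarrow> plane \<Rightarrow> plane \<Rightarrow> real) \<Rightarrow> bool" where
  "riem_complete g \<longleftrightarrow>
     (\<forall>\<sigma> :: nat \<Rightarrow> plane.
        (\<forall>\<epsilon>>0. \<exists>N. \<forall>m\<ge>N. \<forall>n\<ge>N. riem_dist g (\<sigma> m) (\<sigma> n) < \<epsilon>) \<longrightarrow>
        (\<exists>p. (\<lambda>n. riem_dist g (\<sigma> n) p) \<longlonglongrightarrow> 0))"

text \<open>A foliation is given as the set of its leaves. In a foliation chart, whose image is taken
  to be the whole plane, the connected components of the traces of leaves are exactly
  horizontal lines.\<close>

definition foliation :: "plane set set \<Rightarrow> bool" where
  "foliation F \<longleftrightarrow>
     partition_on UNIV F \<and> (\<forall>L\<in>F. connected L) \<and>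
     (\<forall>p. \<exists>U \<phi> \<psi>. open U \<and> p \<in> U \<and> homeomorphism U (UNIV :: plane set) \<phi> \<psi> \<and>
        (\<forall>L\<in>F. \<forall>C\<in>components (L \<inter> U). \<exists>c. \<phi> ` C = {z. snd z = c}))"

text \<open>No leaf of a foliation of the plane is a circle, so every leaf which is a C^1 curve has a
  regular injective C^1 parametrization by the whole real line.\<close>

definition C1_parametrization ::
    "(real \<Rightarrow> plane) \<Rightarrow> (real \<Rightarrow> plane) \<Rightarrow> plane set \<Rightarrow> bool" where
  "C1_parametrization \<gamma> \<gamma>' L \<longleftrightarrow>
     inj \<gamma> \<and> range \<gamma> = L \<and> (\<forall>t. (\<gamma> has_vector_derivative \<gamma>' t) (at t)) \<and>
     continuous_on UNIV \<gamma>' \<and> (\<forall>t. \<gamma>' t \<noteq> 0)"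

definition C1_leaves :: "plane set set \<Rightarrow> bool" where
  "C1_leaves F \<longleftrightarrow> (\<forall>L\<in>F. \<exists>\<gamma> \<gamma>'. C1_parametrization \<gamma> \<gamma>' L)"

definition tangent_to_leaf :: "plane set set \<Rightarrow> plane \<Rightarrow> plane \<Rightarrow> bool" where
  "tangent_to_leaf F p v \<longleftrightarrow>
     (\<exists>L\<in>F. \<exists>\<gamma> \<gamma>' t c. C1_parametrization \<gamma> \<gamma>' L \<and> \<gamma> t = p \<and> v = c *\<^sub>R \<gamma>' t)"

definition leaf_invariant :: "(plane \<Rightarrow> plane) \<Rightarrow> plane set set \<Rightarrow> bool" where
  "leaf_invariant f F \<longleftrightarrow> (\<forall>L\<in>F. f ` L \<in> F)"

definition maps_leaves_onto ::
    "(plane \<Rightarrow> plane) \<Rightarrow> plane set set \<Rightarrow> plane set set \<Rightarrow> bool" where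
  "maps_leaves_onto h F G \<longleftrightarrow> (\<lambda>L. h ` L) ` F = G"

definition vertical_lines :: "plane set set" where
  "vertical_lines = {{p. fst p = c} | c. True}"

definition horizontal_lines :: "plane set set" where
  "horizontal_lines = {{p. snd p = c} | c. True}"

definition anosov_structure ::
    "(plane \<Rightarrow> plane) \<Rightarrow> (plane \<Rightarrow> plane \<Rightarrow> plane \<Rightarrow> real) \<Rightarrow>
     plane set set \<Rightarrow> plane set set \<Rightarrow> bool" where
  "anosov_structure f g Fs Fu \<longleftrightarrow>
     diffeomorphism f \<and> riemannian_metric g \<and> riem_complete g \<and>
     foliation Fs \<and> C1_leaves Fs \<and> leaf_invariant f Fs \<and>
     foliation Fu \<and> C1_leaves Fu \<and> leaf_invariant f Fu \<and>
     (\<exists>C>0. \<exists>\<Lambda>>1. \<forall>n::nat. n > 0 \<longrightarrow>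
        (\<forall>p v. tangent_to_leaf Fu p v \<longrightarrow>
           riem_norm g ((f ^^ n) p) (frechet_derivative (f ^^ n) (at p) v)
             \<ge> C * \<Lambda> ^ n * riem_norm g p v) \<and>
        (\<forall>p v. tangent_to_leaf Fs p v \<longrightarrow>
           riem_norm g ((f ^^ n) p) (frechet_derivative (f ^^ n) (at p) v)
             \<le> C * inverse (\<Lambda> ^ n) * riem_norm g p v))"

text \<open>Eigenvalues of different moduli cannot be complex conjugate, so they are real.\<close>

definition linear_hyperbolic :: "(plane \<Rightarrow> plane) \<Rightarrow> bool" where
  "linear_hyperbolic f \<longleftrightarrow>
     linear f \<and> bij f \<and>
     (\<exists>\<alpha> v. v \<noteq> 0 \<and> f v = \<alpha> *\<^sub>R v \<and> \<bar>\<alpha>\<bar> < 1) \<and>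
     (\<exists>\<beta> w. w \<noteq> 0 \<and> f w = \<beta> *\<^sub>R w \<and> \<bar>\<beta>\<bar> > 1)"

text \<open>The fields below are bounded and smooth, so their maximal integral curves are defined for
  all times.\<close>

definition integral_leaves :: "(plane \<Rightarrow> plane) \<Rightarrow> plane set set" where
  "integral_leaves X =
     {range \<gamma> | \<gamma>. \<forall>t::real. (\<gamma> has_vector_derivative X (\<gamma> t)) (at t)}"

definition parabola_strip :: "plane set set \<Rightarrow> real \<Rightarrow> real \<Rightarrow> bool" where
  "parabola_strip F a b \<longleftrightarrow>
     a < b \<and> {p. fst p = a} \<in> F \<and> {p. fst p = b} \<in> F \<and>
     (\<exists>u :: real \<Rightarrow> real.
        ((filterlim u at_top (at_right a) \<and> filterlim u at_top (at_left b)) \<or>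
         (filterlim u at_bot (at_right a) \<and> filterlim u at_bot (at_left b))) \<and>
        {L \<in> F. L \<subseteq> {a<..<b} \<times> UNIV} = {(\<lambda>x. (x, u x + c)) ` {a<..<b} | c. True})"

text \<open>The frames of White's construction. His stable foliation is
  \<^term>\<open>integral_leaves e_s\<close>; it depends on the frame only, not on the metric.\<close>

definition white_frame :: "(plane \<Rightarrow> plane) \<Rightarrow> (plane \<Rightarrow> plane) \<Rightarrow> bool" where
  "white_frame e_s e_u \<longleftrightarrow>
     smooth e_s \<and> smooth e_u \<and>
     (\<forall>p. norm (e_s p) = 1 \<and> norm (e_u p) = 1 \<and> inner (e_s p) (e_u p) = 0) \<and>
     (\<forall>x y c. e_s (x, y + c) = e_s (x, y) \<and> e_u (x, y + c) = e_u (x, y)) \<and>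
     (\<forall>x y. e_s (x + 2, y) = e_s (x, y) \<and> e_u (x + 2, y) = e_u (x, y)) \<and>
     (\<exists>a b. a < b \<and> (\<forall>x\<in>{a..b}. \<forall>y. snd (e_s (x, y)) = 0)) \<and>
     (\<exists>a b. a < b \<and> (\<forall>x\<in>{a..b}. \<forall>y. snd (e_u (x, y)) = 0)) \<and>
     (\<exists>a b. parabola_strip (integral_leaves e_s) a b)"

end

theory Submission
  imports Defs
begin

text \<open>Restrict the hyperbolic map \<open>(x, y) \<mapsto> (2 x, y / 2)\<close>, with its vertical and horizontal foliations,
  to an invariant open region, and multiply the Euclidean metric by an invariant factor, a function
  of \<open>x y\<close> at least 1, which blows up at the boundary fast enough for completeness. The factor
  being invariant, the expansion and contraction rates are unaffected.

  On \<open>{\<bar>x y\<bar> < 1}\<close>, which is equivariantly diffeomorphic to the whole plane, a vertical line far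
  from the axis misses a horizontal line far from the axis; this gives the first part.

  On the open quadrant the map is conjugate (with \<open>e\<close> in place of 2) to a translation, and the
  stable foliation is a product, so that its leaf space is Hausdorff, whereas White's foliation has
  non-separated leaves, the two sides of a parabola strip; this gives the second part.\<close>

section \<open>Smooth functions\<close>

lemma Ck_const: "Ck k (\<lambda>p. c)"
proof (induction k arbitrary: c)
  case (Suc k)
  show ?case
    unfolding Ck.simps by (rule exI[of _ "\<lambda>p v. 0"]) (simp add: Suc)
qed simp

text \<open>Products and exponentials leave undifferentiated factors in their derivatives; this
  lowers the order of such factors to that of the induction hypothesis.\<close>

lemma Ck_Suc_imp_Ck: "Ck (Suc k) f \<Longrightarrow> Ck k f"
proof (induction k arbitrary: f)
  case 0
  then obtain f' where "\<And>p. (f has_derivative f' p) (at p)" by auto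
  then have "continuous_on UNIV f"
    by (intro has_derivative_continuous_on) (auto intro: has_derivative_at_withinI)
  then show ?case by simp
next
  case (Suc k)
  then obtain f' where "\<forall>p. (f has_derivative f' p) (at p)" "\<forall>v. Ck (Suc k) (\<lambda>p. f' p v)"
    unfolding Ck.simps(2)[of "Suc k"] by blast
  with Suc.IH show ?case unfolding Ck.simps(2)[of k] by blast
qed

lemma Ck_bounded_linear: "bounded_linear f \<Longrightarrow> Ck k f"
proof (cases k)
  case 0
  assume "bounded_linear f"
  with 0 show ?thesis by (simp add: linear_continuous_on)
next
  case (Suc j)
  assume "bounded_linear f"
  then show ?thesis unfolding Suc Ck.simps
    by (intro exI[of _ "\<lambda>p. f"]) (auto simp: Ck_const bounded_linear_imp_has_derivative)
qed

lemma Ck_add: "Ck k f \<Longrightarrow> Ck k g \<Longrightarrow> Ck k (\<lambda>p. f p + g p)"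
proof (induction k arbitrary: f g)
  case 0
  then show ?case by (simp add: continuous_on_add)
next
  case (Suc k)
  from Suc.prems(1) obtain f' where
    f': "\<And>p. (f has_derivative f' p) (at p)" "\<And>v. Ck k (\<lambda>p. f' p v)" by auto
  from Suc.prems(2) obtain g' where
    g': "\<And>p. (g has_derivative g' p) (at p)" "\<And>v. Ck k (\<lambda>p. g' p v)" by auto
  show ?case unfolding Ck.simps
    by (intro exI[of _ "\<lambda>p v. f' p v + g' p v"] conjI allI has_derivative_add f' g' Suc.IH)
qed

lemma Ck_mult:
  fixes f g :: "plane \<Rightarrow> real"
  shows "Ck k f \<Longrightarrow> Ck k g \<Longrightarrow> Ck k (\<lambda>p. f p * g p)"
proof (induction k arbitrary: f g)
  case 0
  then show ?case by (simp add: continuous_on_mult)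
next
  case (Suc k)
  from Suc.prems(1) obtain f' where
    f': "\<And>p. (f has_derivative f' p) (at p)" "\<And>v. Ck k (\<lambda>p. f' p v)" by auto
  from Suc.prems(2) obtain g' where
    g': "\<And>p. (g has_derivative g' p) (at p)" "\<And>v. Ck k (\<lambda>p. g' p v)" by auto
  show ?case unfolding Ck.simps
    by (intro exI[of _ "\<lambda>p v. f p * g' p v + f' p v * g p"] conjI allI has_derivative_mult
        Ck_add Suc.IH f' g' Suc.prems[THEN Ck_Suc_imp_Ck])
qed

lemma Ck_exp:
  fixes f :: "plane \<Rightarrow> real"
  shows "Ck k f \<Longrightarrow> Ck k (\<lambda>p. exp (f p))"
proof (induction k arbitrary: f)
  case 0
  then show ?case by (simp add: continuous_on_exp)
next
  case (Suc k)
  from Suc.prems obtain f' where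
    f': "\<And>p. (f has_derivative f' p) (at p)" "\<And>v. Ck k (\<lambda>p. f' p v)" by auto
  have "((\<lambda>p. exp (f p)) has_derivative (\<lambda>v. exp (f p) * f' p v)) (at p)" for p
    using f'(1)[of p] by (auto intro!: derivative_eq_intros)
  moreover have "Ck k (\<lambda>p. exp (f p) * f' p v)" for v
    by (intro Ck_mult Suc.IH f' Suc.prems[THEN Ck_Suc_imp_Ck])
  ultimately show ?case unfolding Ck.simps
    by (intro exI[of _ "\<lambda>p v. exp (f p) * f' p v"]) blast
qed

named_theorems smooth_intros

lemma smooth_const [smooth_intros]: "smooth (\<lambda>p. c)"
  by (simp add: smooth_def Ck_const)

lemma smooth_bounded_linear: "bounded_linear f \<Longrightarrow> smooth f"
  by (simp add: smooth_def Ck_bounded_linear)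

lemma smooth_fst [smooth_intros]: "smooth fst"
  and smooth_snd [smooth_intros]: "smooth snd"
  by (auto intro: smooth_bounded_linear bounded_linear_fst bounded_linear_snd)

lemma smooth_add [smooth_intros]: "smooth f \<Longrightarrow> smooth g \<Longrightarrow> smooth (\<lambda>p. f p + g p)"
  by (simp add: smooth_def Ck_add)

lemma smooth_mult [smooth_intros]:
  fixes f g :: "plane \<Rightarrow> real"
  shows "smooth f \<Longrightarrow> smooth g \<Longrightarrow> smooth (\<lambda>p. f p * g p)"
  by (simp add: smooth_def Ck_mult)

lemma smooth_minus [smooth_intros]:
  fixes f :: "plane \<Rightarrow> real"
  shows "smooth f \<Longrightarrow> smooth (\<lambda>p. - f p)"
  using smooth_mult[OF smooth_const[of "-1"], of f] by simp

lemma smooth_diff [smooth_intros]: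
  fixes f g :: "plane \<Rightarrow> real"
  shows "smooth f \<Longrightarrow> smooth g \<Longrightarrow> smooth (\<lambda>p. f p - g p)"
  using smooth_add[OF _ smooth_minus, of f g] by simp

lemma smooth_power [smooth_intros]:
  fixes f :: "plane \<Rightarrow> real"
  shows "smooth f \<Longrightarrow> smooth (\<lambda>p. f p ^ n)"
  by (induction n) (auto intro: smooth_intros)

lemma smooth_exp [smooth_intros]:
  fixes f :: "plane \<Rightarrow> real"
  shows "smooth f \<Longrightarrow> smooth (\<lambda>p. exp (f p))"
  by (simp add: smooth_def Ck_exp)

lemma smooth_imp_continuous_on: "smooth f \<Longrightarrow> continuous_on S f"
  by (metis Ck.simps(1) continuous_on_subset smooth_def subset_UNIV)

section \<open>Completeness\<close>

text \<open>A relation rather than a function, so that a path whose speed is not integrable has no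
  length and drops out of the infimum.\<close>

definition path_length ::
    "(plane \<Rightarrow> plane \<Rightarrow> plane \<Rightarrow> real) \<Rightarrow> (real \<Rightarrow> plane) \<Rightarrow> plane \<Rightarrow> plane \<Rightarrow> real \<Rightarrow> bool" where
  "path_length g \<gamma> p q l \<longleftrightarrow> valid_path \<gamma> \<and> pathstart \<gamma> = p \<and> pathfinish \<gamma> = q \<and>
     ((\<lambda>t. riem_norm g (\<gamma> t) (vector_derivative \<gamma> (at t))) has_integral l) {0..1}"

lemma riem_dist_eq_Inf: "riem_dist g p q = Inf {l. \<exists>\<gamma>. path_length g \<gamma> p q l}"
  by (simp add: riem_dist_def path_length_def)

lemma riemannian_metric_bilinear: "riemannian_metric g \<Longrightarrow> bilinear (g p)"
  unfolding riemannian_metric_def by blast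

lemma riemannian_metric_sym: "riemannian_metric g \<Longrightarrow> g p v w = g p w v"
  unfolding riemannian_metric_def by blast

lemma riemannian_metric_continuous_on:
  "riemannian_metric g \<Longrightarrow> continuous_on S (\<lambda>p. g p v w)"
  unfolding riemannian_metric_def by (blast intro: smooth_imp_continuous_on)

lemma riem_norm_nonneg: "riemannian_metric g \<Longrightarrow> 0 \<le> riem_norm g p v"
  unfolding riem_norm_def riemannian_metric_def
  by (metis bilinear_lzero less_eq_real_def real_sqrt_ge_0_iff)

lemma path_length_nonneg:
  assumes "riemannian_metric g" "path_length g \<gamma> p q l"
  shows "0 \<le> l"
  using assms unfolding path_length_def
  by (auto intro: has_integral_nonneg riem_norm_nonneg)

text \<open>Along the path, \<open>F\<close> is the integral of \<open>F'\<close> applied to the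
  velocity, whose norm is at most \<open>M\<close> times the speed. Stopping at an arbitrary
  \<open>s\<close> controls every point of the path and not only its end.\<close>

lemma path_displacement_le:
  fixes F :: "plane \<Rightarrow> 'b::banach"
  assumes g: "riemannian_metric g" and len: "path_length g \<gamma> p q l"
    and dF: "\<And>z. (F has_derivative F' z) (at z)"
    and le: "\<And>z v. z \<in> S \<Longrightarrow> norm (F' z v) \<le> M * riem_norm g z v"
    and S: "path_image \<gamma> \<subseteq> S" and M: "0 \<le> M" and s: "s \<in> {0..1}"
  shows "norm (F (\<gamma> s) - F p) \<le> M * l"
proof -
  let ?V = "\<lambda>t. vector_derivative \<gamma> (at t)"
  let ?N = "\<lambda>t. riem_norm g (\<gamma> t) (?V t)"
  from len obtain E where cont: "continuous_on {0..1} \<gamma>" and E: "finite E"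
    and C1: "\<gamma> C1_differentiable_on ({0..1} - E)"
    by (auto simp: path_length_def valid_path_def piecewise_C1_differentiable_on_def)
  have dg: "(\<gamma> has_vector_derivative ?V t) (at t)" if "t \<in> {0..1} - E" for t
    using C1 that by (auto simp: C1_differentiable_on_eq vector_derivative_works)
  have dFg: "((F \<circ> \<gamma>) has_vector_derivative F' (\<gamma> t) (?V t)) (at t)" if "t \<in> {0..1} - E" for t
    using diff_chain_at[OF dg[OF that, unfolded has_vector_derivative_def] dF[of "\<gamma> t"]]
    unfolding has_vector_derivative_def
    by (simp add: o_def linear_cmul[OF has_derivative_linear[OF dF]])
  have contF: "continuous_on UNIV F"
    by (intro has_derivative_continuous_on) (auto intro: has_derivative_at_withinI dF)
  \<comment> \<open>At the finitely many parameters in \<open>E\<close> this form of the fundamental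
    theorem asks only for continuity.\<close>
  have "((\<lambda>t. F' (\<gamma> t) (?V t)) has_integral (F \<circ> \<gamma>) s - (F \<circ> \<gamma>) 0) {0..s}"
  proof (rule fundamental_theorem_of_calculus_interior_strong[OF E])
    show "continuous_on {0..s} (F \<circ> \<gamma>)"
      using s by (intro continuous_on_compose continuous_on_subset[OF cont]
          continuous_on_subset[OF contF]) auto
  qed (use s dFg in \<open>auto simp: o_def\<close>)
  moreover have int1: "?N integrable_on {0..1}" "integral {0..1} ?N = l"
    using len by (auto simp: path_length_def)
  moreover have int2: "?N integrable_on {0..s}"
    by (rule integrable_on_subinterval[OF int1(1)]) (use s in auto)
  moreover have "norm (integral {0..s} (\<lambda>t. F' (\<gamma> t) (?V t))) \<le> integral {0..s} (\<lambda>t. M * ?N t)"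
  proof (rule integral_norm_bound_integral)
    fix t assume "t \<in> {0..s}"
    then have "\<gamma> t \<in> S" using S s by (auto simp: path_image_def)
    then show "norm (F' (\<gamma> t) (?V t)) \<le> M * ?N t" by (rule le)
  qed (use calculation in \<open>auto intro: integrable_on_mult_right\<close>)
  moreover have "integral {0..s} ?N \<le> integral {0..1} ?N"
    by (rule integral_subset_le) (use s int1 int2 riem_norm_nonneg[OF g] in auto)
  ultimately have "norm (F (\<gamma> s) - F (\<gamma> 0)) \<le> M * l"
    using M by (auto simp: integral_unique intro: order_trans mult_left_mono)
  then show ?thesis using len by (auto simp: path_length_def pathstart_def)
qed

text \<open>The entries of \<open>g\<close> in the standard basis are continuous, hence bounded on
  \<open>K\<close>, and they bound the quadratic form.\<close>

lemma riem_norm_locally_le_norm: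
  assumes g: "riemannian_metric g" and K: "compact K"
  obtains M where "0 \<le> M" "\<And>z v. z \<in> K \<Longrightarrow> riem_norm g z v \<le> M * norm v"
proof -
  note cont = riemannian_metric_continuous_on[OF g]
  have "\<exists>B. \<forall>z\<in>K. \<bar>g z v w\<bar> \<le> B" for v w
    using compact_imp_bounded[OF compact_continuous_image[OF cont K, of v w]]
    by (simp add: bounded_iff)
  then obtain B where B: "\<And>v w z. z \<in> K \<Longrightarrow> \<bar>g z v w\<bar> \<le> B v w" by metis
  define M where "M = \<bar>B (1,0) (1,0)\<bar> + 2 * \<bar>B (1,0) (0,1)\<bar> + \<bar>B (0,1) (0,1)\<bar>"
  have M0: "0 \<le> M" by (simp add: M_def)
  show ?thesis
  proof
    show "0 \<le> sqrt M" using M0 by simp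
    fix z v assume z: "z \<in> K"
    obtain a b :: real where v: "v = (a, b)" by (cases v)
    note bil = riemannian_metric_bilinear[OF g, of z]
      and sym = riemannian_metric_sym[OF g, of z "(0,1)" "(1,0)"]
    have v': "v = a *\<^sub>R (1,0) + b *\<^sub>R (0,1)" by (simp add: v)
    have "g z v v = a^2 * g z (1,0) (1,0) + 2 * (a * b) * g z (1,0) (0,1) + b^2 * g z (0,1) (0,1)"
      unfolding v' bilinear_ladd[OF bil] bilinear_radd[OF bil] bilinear_lmul[OF bil]
        bilinear_rmul[OF bil] sym by (simp add: power2_eq_square algebra_simps)
    also have "\<dots> \<le> (a^2 + b^2) * \<bar>B (1,0) (1,0)\<bar> + 2 * ((a^2 + b^2) * \<bar>B (1,0) (0,1)\<bar>)
        + (a^2 + b^2) * \<bar>B (0,1) (0,1)\<bar>"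
    proof -
      have "a^2 * g z (1,0) (1,0) \<le> (a^2 + b^2) * \<bar>B (1,0) (1,0)\<bar>"
        using B[OF z, of "(1,0)" "(1,0)"]
        by (intro order_trans[OF mult_left_mono mult_right_mono[of "a^2"]]) auto
      moreover have "b^2 * g z (0,1) (0,1) \<le> (a^2 + b^2) * \<bar>B (0,1) (0,1)\<bar>"
        using B[OF z, of "(0,1)" "(0,1)"]
        by (intro order_trans[OF mult_left_mono mult_right_mono[of "b^2"]]) auto
      moreover have "(a * b) * g z (1,0) (0,1) \<le> (a^2 + b^2) * \<bar>B (1,0) (0,1)\<bar>"
      proof -
        have "\<bar>a * b\<bar> \<le> a^2 + b^2"
          using sum_squares_bound[of a b] sum_squares_bound[of a "-b"] zero_le_power2[of a]
            zero_le_power2[of b] by (auto simp: abs_le_iff simp del: zero_le_power2)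
        then have "\<bar>a * b\<bar> * \<bar>g z (1,0) (0,1)\<bar> \<le> (a^2 + b^2) * \<bar>B (1,0) (0,1)\<bar>"
          using B[OF z, of "(1,0)" "(0,1)"] by (intro mult_mono) auto
        then show ?thesis by (simp add: abs_mult[symmetric])
      qed
      ultimately show ?thesis by linarith
    qed
    also have "\<dots> = M * (norm v)^2"
      by (simp add: M_def v norm_Pair algebra_simps)
    finally show "riem_norm g z v \<le> sqrt M * norm v"
      unfolding riem_norm_def using real_sqrt_le_mono by (fastforce simp: real_sqrt_mult)
  qed
qed

text \<open>The segment shows that the infimum defining the distance is over a nonempty set, and its
  length is an upper bound for the distance.\<close>

lemma linepath_length:
  assumes g: "riemannian_metric g"
  obtains l where "path_length g (linepath p q) p q l"
    "\<And>M. (\<And>z. z \<in> closed_segment p q \<Longrightarrow> riem_norm g z (q - p) \<le> M) \<Longrightarrow> l \<le> M"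
proof -
  let ?N = "\<lambda>t. riem_norm g (linepath p q t) (q - p)"
  have "continuous_on UNIV (\<lambda>z. riem_norm g z (q - p))"
    unfolding riem_norm_def by (intro continuous_on_real_sqrt riemannian_metric_continuous_on[OF g])
  then have "continuous_on {0..1} ?N"
    by (rule continuous_on_compose2) (auto intro: continuous_on_linepath)
  then have int: "(?N has_integral integral {0..1} ?N) {0..1}"
    by (intro integrable_integral integrable_continuous_real)
  show ?thesis
  proof
    show "path_length g (linepath p q) p q (integral {0..1} ?N)"
      using int by (simp add: path_length_def valid_path_linepath)
    fix M assume "\<And>z. z \<in> closed_segment p q \<Longrightarrow> riem_norm g z (q - p) \<le> M"
    then have "?N t \<le> M" if "t \<in> {0..1}" for t
      using that by (simp add: linepath_in_path)
    then show "integral {0..1} ?N \<le> M"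
      using has_integral_le[OF int has_integral_const_real[of M 0 1]] by simp
  qed
qed

lemma riem_dist_lessE:
  assumes "riemannian_metric g" "riem_dist g p q < \<epsilon>"
  obtains \<gamma> l where "path_length g \<gamma> p q l" "l < \<epsilon>"
proof -
  have "{l. \<exists>\<gamma>. path_length g \<gamma> p q l} \<noteq> {}"
    using linepath_length[OF assms(1), of p q] by blast
  then show ?thesis
    using cInf_lessD[of "{l. \<exists>\<gamma>. path_length g \<gamma> p q l}" \<epsilon>] assms(2) that
    unfolding riem_dist_eq_Inf by blast
qed

lemma riem_dist_le:
  assumes "riemannian_metric g" "path_length g \<gamma> p q l"
  shows "riem_dist g p q \<le> l"
  unfolding riem_dist_eq_Inf
  by (intro cInf_lower bdd_belowI[of _ 0]) (use assms path_length_nonneg in blast)+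

lemma riem_dist_nonneg:
  assumes "riemannian_metric g"
  shows "0 \<le> riem_dist g p q"
proof (rule ccontr)
  assume "\<not> ?thesis"
  then obtain \<gamma> l where "path_length g \<gamma> p q l" "l < 0"
    using riem_dist_lessE[OF assms, of p q 0] by auto
  then show False using path_length_nonneg[OF assms] by fastforce
qed

lemma tendsto_imp_riem_dist_tendsto_0:
  assumes g: "riemannian_metric g" and lim: "\<sigma> \<longlonglongrightarrow> p"
  shows "(\<lambda>n. riem_dist g (\<sigma> n) p) \<longlonglongrightarrow> 0"
proof -
  obtain M where M: "\<And>z v. z \<in> cball p 1 \<Longrightarrow> riem_norm g z v \<le> M * norm v"
    using riem_norm_locally_le_norm[OF g compact_cball] by metis
  have "riem_dist g q p \<le> M * norm (p - q)" if q: "q \<in> ball p 1" for q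
  proof -
    \<comment> \<open>Balls are convex, so one constant \<open>M\<close> serves on every segment
      from a nearby point to \<open>p\<close>.\<close>
    have "closed_segment q p \<subseteq> cball p 1"
      using q by (intro closed_segment_subset) auto
    with M have "\<And>z. z \<in> closed_segment q p \<Longrightarrow> riem_norm g z (p - q) \<le> M * norm (p - q)"
      by blast
    with linepath_length[OF g, of q p] riem_dist_le[OF g] show ?thesis
      by (metis order_trans)
  qed
  moreover have "\<forall>\<^sub>F n in sequentially. \<sigma> n \<in> ball p 1"
    by (rule topological_tendstoD[OF lim]) auto
  ultimately have le: "\<forall>\<^sub>F n in sequentially. riem_dist g (\<sigma> n) p \<le> M * norm (p - \<sigma> n)"
    by (rule eventually_mono[rotated])
  have "(\<lambda>n. M * norm (p - \<sigma> n)) \<longlonglongrightarrow> M * norm (p - p)"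
    by (intro tendsto_intros lim)
  then have "(\<lambda>n. M * norm (p - \<sigma> n)) \<longlonglongrightarrow> 0" by simp
  then show ?thesis
    by (intro tendsto_sandwich[OF _ le tendsto_const]) (simp_all add: riem_dist_nonneg[OF g])
qed

section \<open>Confinement of short paths and a criterion for completeness\<close>

definition riem_Cauchy ::
    "(plane \<Rightarrow> plane \<Rightarrow> plane \<Rightarrow> real) \<Rightarrow> (nat \<Rightarrow> plane) \<Rightarrow> bool" where
  "riem_Cauchy g \<sigma> \<longleftrightarrow> (\<forall>\<epsilon>>0. \<exists>N. \<forall>m\<ge>N. \<forall>n\<ge>N. riem_dist g (\<sigma> m) (\<sigma> n) < \<epsilon>)"

text \<open>Whole paths are confined, not just the terms of the sequence, because a derivative
  estimate must hold all along a path to compare its ends. The threshold 1 is an arbitrary fixed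
  length.\<close>

definition short_paths_in ::
    "(plane \<Rightarrow> plane \<Rightarrow> plane \<Rightarrow> real) \<Rightarrow> (nat \<Rightarrow> plane) \<Rightarrow> plane set \<Rightarrow> bool" where
  "short_paths_in g \<sigma> S \<longleftrightarrow>
     (\<exists>N. \<forall>m\<ge>N. \<forall>n\<ge>N. \<forall>\<gamma> l. path_length g \<gamma> (\<sigma> m) (\<sigma> n) l \<longrightarrow> l < 1 \<longrightarrow> path_image \<gamma> \<subseteq> S)"

lemma short_paths_in_UNIV: "short_paths_in g \<sigma> UNIV"
  by (simp add: short_paths_in_def)

text \<open>A function which is Lipschitz on the region containing the short paths is bounded on them,
  which confines them to a smaller region, on which further functions may be Lipschitz.\<close>

lemma short_paths_in_bounded:
  fixes F :: "plane \<Rightarrow> 'b::banach"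
  assumes g: "riemannian_metric g" and Cau: "riem_Cauchy g \<sigma>" and sh: "short_paths_in g \<sigma> S"
    and dF: "\<And>z. (F has_derivative F' z) (at z)"
    and le: "\<And>z v. z \<in> S \<Longrightarrow> norm (F' z v) \<le> M * riem_norm g z v"
    and M: "0 \<le> M"
  obtains R where "0 \<le> R" "short_paths_in g \<sigma> (S \<inter> {z. norm (F z) \<le> R})"
proof -
  from sh obtain N1 where N1: "\<And>m n \<gamma> l. N1 \<le> m \<Longrightarrow> N1 \<le> n \<Longrightarrow>
      path_length g \<gamma> (\<sigma> m) (\<sigma> n) l \<Longrightarrow> l < 1 \<Longrightarrow> path_image \<gamma> \<subseteq> S"
    unfolding short_paths_in_def by blast
  from Cau obtain N2 where N2: "\<And>m n. N2 \<le> m \<Longrightarrow> N2 \<le> n \<Longrightarrow> riem_dist g (\<sigma> m) (\<sigma> n) < 1"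
    unfolding riem_Cauchy_def by (metis zero_less_one)
  define N where "N = max N1 N2"
  have disp: "norm (F (\<gamma> s) - F (\<sigma> m)) \<le> M"
    if "N \<le> m" "N \<le> n" "path_length g \<gamma> (\<sigma> m) (\<sigma> n) l" "l < 1" "s \<in> {0..1}" for m n \<gamma> l s
  proof -
    have "path_image \<gamma> \<subseteq> S" using N1[OF _ _ that(3,4)] that by (simp add: N_def)
    then have "norm (F (\<gamma> s) - F (\<sigma> m)) \<le> M * l"
      by (intro path_displacement_le[OF g that(3) dF le _ M that(5)])
    also have "\<dots> \<le> M * 1" using M that by (intro mult_left_mono) auto
    finally show ?thesis by simp
  qed
  have start: "norm (F (\<sigma> m) - F (\<sigma> N)) \<le> M" if "N \<le> m" for m
  proof -
    have "riem_dist g (\<sigma> N) (\<sigma> m) < 1" using that by (intro N2) (auto simp: N_def)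
    from riem_dist_lessE[OF g this]
    obtain \<gamma> l where \<gamma>: "path_length g \<gamma> (\<sigma> N) (\<sigma> m) l" "l < 1" .
    then show ?thesis
      using disp[of N m \<gamma> l 1] that by (auto simp: path_length_def pathfinish_def)
  qed
  show ?thesis
  proof
    \<comment> \<open>One \<open>M\<close> accounts for the way from \<open>\<sigma> N\<close> to
      the start \<open>\<sigma> m\<close> of the path, the other for the way along the path.\<close>
    show "0 \<le> norm (F (\<sigma> N)) + 2 * M" using M by simp
    have "norm (F (\<gamma> s)) \<le> norm (F (\<sigma> N)) + 2 * M"
      if "N \<le> m" "N \<le> n" "path_length g \<gamma> (\<sigma> m) (\<sigma> n) l" "l < 1" "s \<in> {0..1}" for m n \<gamma> l s
      using disp[OF that] start[OF that(1)]
        norm_triangle_sub[of "F (\<gamma> s)" "F (\<sigma> m)"] norm_triangle_sub[of "F (\<sigma> m)" "F (\<sigma> N)"]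
      by linarith
    moreover have "path_image \<gamma> \<subseteq> S"
      if "N \<le> m" "N \<le> n" "path_length g \<gamma> (\<sigma> m) (\<sigma> n) l" "l < 1" for m n \<gamma> l
      using N1[OF _ _ that(3,4)] that by (simp add: N_def)
    ultimately show "short_paths_in g \<sigma> (S \<inter> {z. norm (F z) \<le> norm (F (\<sigma> N)) + 2 * M})"
      unfolding short_paths_in_def
      by (intro exI[of _ N]) (auto simp: path_image_def image_subset_iff)
  qed
qed

text \<open>On \<open>S\<close> the metric dominates the Euclidean one, so a Cauchy sequence for
  \<open>g\<close> is a Euclidean Cauchy sequence. Its Euclidean limit is also a limit for
  \<open>g\<close>, by the local comparison in the other direction.\<close>

lemma riem_completeI:
  assumes g: "riemannian_metric g"
    and ex: "\<And>\<sigma>. riem_Cauchy g \<sigma> \<Longrightarrow>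
      \<exists>S M. short_paths_in g \<sigma> S \<and> (\<forall>z\<in>S. \<forall>v. norm v \<le> M * riem_norm g z v)"
  shows "riem_complete g"
  unfolding riem_complete_def riem_Cauchy_def[symmetric]
proof (intro allI impI)
  fix \<sigma> assume Cau: "riem_Cauchy g \<sigma>"
  from ex[OF this] obtain S M0 where sh: "short_paths_in g \<sigma> S"
    and le0: "\<And>z v. z \<in> S \<Longrightarrow> norm v \<le> M0 * riem_norm g z v" by blast
  \<comment> \<open>The constant \<open>M0\<close> may fail to be positive, for instance when
    \<open>S\<close> is empty; a positive one is wanted for dividing by it.\<close>
  define M where "M = \<bar>M0\<bar> + 1"
  have M: "0 < M" by (simp add: M_def)
  have le: "norm v \<le> M * riem_norm g z v" if "z \<in> S" for z v
    by (rule order_trans[OF le0[OF that]])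
      (auto simp: M_def intro!: mult_right_mono riem_norm_nonneg[OF g])
  from sh obtain N1 where N1: "\<And>m n \<gamma> l. N1 \<le> m \<Longrightarrow> N1 \<le> n \<Longrightarrow>
      path_length g \<gamma> (\<sigma> m) (\<sigma> n) l \<Longrightarrow> l < 1 \<Longrightarrow> path_image \<gamma> \<subseteq> S"
    unfolding short_paths_in_def by blast
  have "Cauchy \<sigma>"
  proof (rule metric_CauchyI)
    fix e :: real assume e: "0 < e"
    \<comment> \<open>The bound 1 keeps the path inside \<open>S\<close>; the bound
      \<open>e / M\<close> then makes its Euclidean displacement less than \<open>e\<close>, by the
      displacement estimate for the identity map.\<close>
    then have "0 < min 1 (e / M)" using M by simp
    with Cau obtain N2 where
      N2: "\<And>m n. N2 \<le> m \<Longrightarrow> N2 \<le> n \<Longrightarrow> riem_dist g (\<sigma> m) (\<sigma> n) < min 1 (e / M)"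
      unfolding riem_Cauchy_def by blast
    have "dist (\<sigma> m) (\<sigma> n) < e" if "max N1 N2 \<le> m" "max N1 N2 \<le> n" for m n
    proof -
      have "riem_dist g (\<sigma> m) (\<sigma> n) < min 1 (e / M)" using that by (intro N2) auto
      from riem_dist_lessE[OF g this]
      obtain \<gamma> l where \<gamma>: "path_length g \<gamma> (\<sigma> m) (\<sigma> n) l" "l < min 1 (e / M)" .
      then have "path_image \<gamma> \<subseteq> S" using that by (intro N1[OF _ _ \<gamma>(1)]) auto
      then have "norm (\<gamma> 1 - \<sigma> m) \<le> M * l"
        using M by (intro path_displacement_le[OF g \<gamma>(1) has_derivative_ident le]) auto
      then show ?thesis
        using \<gamma> M by (auto simp: path_length_def pathfinish_def dist_norm norm_minus_commute
            field_simps)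
    qed
    then show "\<exists>N. \<forall>m\<ge>N. \<forall>n\<ge>N. dist (\<sigma> m) (\<sigma> n) < e" by blast
  qed
  then obtain p where "\<sigma> \<longlonglongrightarrow> p" by (auto simp: Cauchy_convergent_iff convergent_def)
  with tendsto_imp_riem_dist_tendsto_0[OF g]
  show "\<exists>p. (\<lambda>n. riem_dist g (\<sigma> n) p) \<longlonglongrightarrow> 0" by blast
qed


section \<open>Foliations by level sets\<close>

definition level_sets :: "(plane \<Rightarrow> real) \<Rightarrow> plane set set" where
  "level_sets P = {{p. P p = c} | c. True}"

lemma vertical_lines_eq_level_sets: "vertical_lines = level_sets fst"
  by (simp add: vertical_lines_def level_sets_def)

lemma horizontal_lines_eq_level_sets: "horizontal_lines = level_sets snd"
  by (simp add: horizontal_lines_def level_sets_def)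

text \<open>The global chart serves at every point, with \<open>U = UNIV\<close>: each leaf is the
  preimage of a horizontal line, hence connected and its own only component.\<close>

lemma foliation_level_sets:
  fixes \<phi> \<psi> :: "plane \<Rightarrow> plane"
  assumes hom: "homeomorphism UNIV UNIV \<phi> \<psi>"
  shows "foliation (level_sets (\<lambda>p. snd (\<phi> p)))"
proof -
  let ?L = "\<lambda>c. {p. snd (\<phi> p) = c}"
  have inv: "\<phi> (\<psi> z) = z" "\<psi> (\<phi> p) = p" for z p
    using homeomorphism_apply1[OF hom] homeomorphism_apply2[OF hom] by simp_all
  have img: "?L c = \<psi> ` {z. snd z = c}" for c
    by (rule set_eqI) (metis (mono_tags, lifting) image_iff inv mem_Collect_eq)
  have line: "{z::plane. snd z = c} = UNIV \<times> {c}" for c by auto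
  have conn: "connected (?L c)" for c
    unfolding img
  proof (rule connected_continuous_image)
    show "connected {z::plane. snd z = c}" unfolding line by (intro connected_Times) auto
  qed (rule continuous_on_subset[OF homeomorphism_cont2[OF hom]], simp)
  have ne: "?L c \<noteq> {}" for c
    unfolding img line by simp
  have comp: "components (?L c \<inter> UNIV) = {?L c}" for c
    using conn[of c] ne[of c] by (simp add: components_eq_sing_iff)
  have \<phi>img: "\<phi> ` ?L c = {z. snd z = c}" for c
    unfolding img by (simp add: image_image inv)
  show ?thesis
    unfolding foliation_def
  proof (intro conjI allI)
    show "partition_on UNIV (level_sets (\<lambda>p. snd (\<phi> p)))"
      using ne by (intro partition_onI) (auto simp: level_sets_def disjnt_def)
    show "\<forall>L\<in>level_sets (\<lambda>p. snd (\<phi> p)). connected L"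
      using conn by (auto simp: level_sets_def)
    fix p
    show "\<exists>U \<phi>' \<psi>'. open U \<and> p \<in> U \<and> homeomorphism U (UNIV :: plane set) \<phi>' \<psi>' \<and>
        (\<forall>L\<in>level_sets (\<lambda>p. snd (\<phi> p)). \<forall>C\<in>components (L \<inter> U).
          \<exists>c. \<phi>' ` C = {z. snd z = c})"
    proof (rule exI[of _ UNIV], rule exI[of _ \<phi>], rule exI[of _ \<psi>], intro conjI hom ballI)
      fix L C assume "L \<in> level_sets (\<lambda>p. snd (\<phi> p))" "C \<in> components (L \<inter> UNIV)"
      then obtain c where "C = ?L c"
        using comp unfolding level_sets_def by blast
      with \<phi>img show "\<exists>c. \<phi> ` C = {z. snd z = c}" by blast
    qed auto
  qed
qed

lemma leaf_invariant_level_sets: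
  assumes "bij f" "a \<noteq> 0" and P: "\<And>p. P (f p) = a * P p + b"
  shows "leaf_invariant f (level_sets P)"
proof -
  have "f ` {p. P p = c} = {p. P p = a * c + b}" for c
  proof (intro set_eqI iffI)
    fix q assume "q \<in> {p. P p = a * c + b}"
    moreover obtain p where "q = f p" using \<open>bij f\<close> by (metis bij_pointE)
    ultimately show "q \<in> f ` {p. P p = c}" using P \<open>a \<noteq> 0\<close> by auto
  qed (use P in auto)
  then show ?thesis by (auto simp: leaf_invariant_def level_sets_def)
qed

text \<open>\<open>P\<close> is constant along any parametrization of the leaf, so the chain rule
  annihilates the velocity.\<close>

lemma tangent_to_level_set:
  assumes "tangent_to_leaf (level_sets P) p v" and P: "(P has_derivative P') (at p)"
  shows "P' v = 0"
proof -
  from assms(1) obtain d \<gamma> \<gamma>' t c where par: "C1_parametrization \<gamma> \<gamma>' {p. P p = d}"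
    and p: "\<gamma> t = p" and v: "v = c *\<^sub>R \<gamma>' t"
    unfolding tangent_to_leaf_def level_sets_def by blast
  have lin: "linear P'" using P by (rule has_derivative_linear)
  have const: "P (\<gamma> s) = d" for s
    using par by (auto simp: C1_parametrization_def)
  have "(\<gamma> has_vector_derivative \<gamma>' t) (at t)"
    using par by (auto simp: C1_parametrization_def)
  from diff_chain_at[OF this[unfolded has_vector_derivative_def] P[folded p]]
  have "((\<lambda>s. P (\<gamma> s)) has_vector_derivative P' (\<gamma>' t)) (at t)"
    by (simp add: has_vector_derivative_def o_def linear_cmul[OF lin])
  then have "((\<lambda>s. d) has_vector_derivative P' (\<gamma>' t)) (at t)"
    by (simp add: const)
  then have "P' (\<gamma>' t) = 0"
    by (rule vector_derivative_unique_at) (rule has_vector_derivative_const)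
  then show ?thesis by (simp add: v linear_cmul[OF lin])
qed

section \<open>The foliations by parallel lines\<close>

lemma foliation_vertical_lines: "foliation vertical_lines"
proof -
  \<comment> \<open>Charts are read off in the second coordinate; swapping turns \<open>fst\<close>
    into it.\<close>
  have "homeomorphism UNIV UNIV prod.swap (prod.swap :: plane \<Rightarrow> plane)"
    by (auto simp: homeomorphism_def intro!: continuous_intros surjI[of _ prod.swap])
  from foliation_level_sets[OF this] show ?thesis
    by (simp add: vertical_lines_eq_level_sets)
qed

lemma foliation_horizontal_lines: "foliation horizontal_lines"
  using foliation_level_sets[OF homeomorphism_ident]
  by (simp add: horizontal_lines_eq_level_sets)

lemma C1_leaves_vertical_lines: "C1_leaves vertical_lines"
  unfolding C1_leaves_def
proof
  fix L assume "L \<in> vertical_lines"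
  then obtain c where L: "L = {p. fst p = c}" by (auto simp: vertical_lines_def)
  have "C1_parametrization (\<lambda>t. (c, t)) (\<lambda>t. (0, 1)) L"
    by (auto simp: C1_parametrization_def inj_def L zero_prod_def image_iff
        intro!: derivative_eq_intros)
  then show "\<exists>\<gamma> \<gamma>'. C1_parametrization \<gamma> \<gamma>' L" by blast
qed

lemma C1_leaves_horizontal_lines: "C1_leaves horizontal_lines"
  unfolding C1_leaves_def
proof
  fix L assume "L \<in> horizontal_lines"
  then obtain c where L: "L = {p. snd p = c}" by (auto simp: horizontal_lines_def)
  have "C1_parametrization (\<lambda>t. (t, c)) (\<lambda>t. (1, 0)) L"
    by (auto simp: C1_parametrization_def inj_def L zero_prod_def image_iff
        intro!: derivative_eq_intros)
  then show "\<exists>\<gamma> \<gamma>'. C1_parametrization \<gamma> \<gamma>' L" by blast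
qed

lemma tangent_to_vertical_line: "tangent_to_leaf vertical_lines p v \<Longrightarrow> fst v = 0"
  unfolding vertical_lines_eq_level_sets
  by (erule tangent_to_level_set) (rule bounded_linear_imp_has_derivative[OF bounded_linear_fst])

lemma tangent_to_horizontal_line: "tangent_to_leaf horizontal_lines p v \<Longrightarrow> snd v = 0"
  unfolding horizontal_lines_eq_level_sets
  by (erule tangent_to_level_set) (rule bounded_linear_imp_has_derivative[OF bounded_linear_snd])

section \<open>Expansion and contraction rates\<close>

lemma riem_norm_scale:
  "g q w w = a\<^sup>2 * g p v v \<Longrightarrow> 0 \<le> a \<Longrightarrow> riem_norm g q w = a * riem_norm g p v"
  by (simp add: riem_norm_def real_sqrt_mult)

text \<open>In both examples the iterates scale tangent vectors exactly, so the constant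
  \<open>C\<close> is 1. The rates are stated for squared norms, which keeps square roots out of the
  computations.\<close>

lemma anosov_structureI:
  assumes "diffeomorphism f" "riemannian_metric g" "riem_complete g"
    "foliation Fs" "C1_leaves Fs" "leaf_invariant f Fs"
    "foliation Fu" "C1_leaves Fu" "leaf_invariant f Fu"
    and der: "\<And>n p. (f ^^ n has_derivative D n p) (at p)" and \<Lambda>: "1 < \<Lambda>"
    and u: "\<And>n p v. tangent_to_leaf Fu p v \<Longrightarrow>
      g ((f ^^ n) p) (D n p v) (D n p v) = (\<Lambda> ^ n)\<^sup>2 * g p v v"
    and s: "\<And>n p v. tangent_to_leaf Fs p v \<Longrightarrow>
      g ((f ^^ n) p) (D n p v) (D n p v) = (inverse (\<Lambda> ^ n))\<^sup>2 * g p v v"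
  shows "anosov_structure f g Fs Fu"
proof -
  have D: "frechet_derivative (f ^^ n) (at p) = D n p" for n p
    using frechet_derivative_at[OF der] by simp
  have "riem_norm g ((f ^^ n) p) (frechet_derivative (f ^^ n) (at p) v) = \<Lambda> ^ n * riem_norm g p v"
    if "tangent_to_leaf Fu p v" for n p v
    unfolding D using \<Lambda> by (intro riem_norm_scale u[OF that]) auto
  moreover have "riem_norm g ((f ^^ n) p) (frechet_derivative (f ^^ n) (at p) v) =
      inverse (\<Lambda> ^ n) * riem_norm g p v" if "tangent_to_leaf Fs p v" for n p v
    unfolding D using \<Lambda> by (intro riem_norm_scale s[OF that]) auto
  ultimately show ?thesis
    unfolding anosov_structure_def using assms(1-9) \<Lambda>
    by (intro conjI exI[of _ 1] exI[of _ \<Lambda>]) simp_all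
qed

section \<open>Vertical lines and parabola strips\<close>

text \<open>A continuous injective \<open>\<gamma>\<close> is strictly monotone, so it cannot come
  close to \<open>\<alpha>\<close>, then to \<open>\<beta>\<close>, then to \<open>\<alpha>\<close>
  again at increasing arguments. Such arguments exist because \<open>u\<close> takes arbitrarily
  large values along either filter.\<close>

lemma continuous_inj_limit_unique:
  fixes \<gamma> :: "real \<Rightarrow> real"
  assumes cont: "continuous_on UNIV \<gamma>" and inj: "inj \<gamma>"
    and u: "filterlim u at_top F" "filterlim u at_top G" "F \<noteq> bot" "G \<noteq> bot"
    and \<alpha>: "((\<lambda>x. \<gamma> (u x)) \<longlongrightarrow> \<alpha>) F" and \<beta>: "((\<lambda>x. \<gamma> (u x)) \<longlongrightarrow> \<beta>) G"
  shows "\<alpha> = \<beta>"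
proof (rule ccontr)
  assume "\<alpha> \<noteq> \<beta>"
  \<comment> \<open>Half the distance makes the two balls disjoint, so values in them are ordered as
    \<open>\<alpha>\<close> and \<open>\<beta>\<close> are.\<close>
  define e where "e = \<bar>\<alpha> - \<beta>\<bar> / 2"
  have e: "0 < e" using \<open>\<alpha> \<noteq> \<beta>\<close> by (simp add: e_def)
  have "\<exists>x. u x > K \<and> dist (\<gamma> (u x)) \<alpha> < e" for K
    using u \<alpha> e
    by (intro eventually_happens'[OF u(3)] eventually_conj tendstoD[OF \<alpha>])
      (auto simp: filterlim_at_top_dense)
  note F = this
  have "\<exists>x. u x > K \<and> dist (\<gamma> (u x)) \<beta> < e" for K
    using u \<beta> e
    by (intro eventually_happens'[OF u(4)] eventually_conj tendstoD[OF \<beta>])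
      (auto simp: filterlim_at_top_dense)
  note G = this
  obtain x1 where x1: "dist (\<gamma> (u x1)) \<alpha> < e" using F by blast
  obtain x2 where x2: "u x1 < u x2" "dist (\<gamma> (u x2)) \<beta> < e" using G by blast
  obtain x3 where x3: "u x2 < u x3" "dist (\<gamma> (u x3)) \<alpha> < e" using F by blast
  have "\<gamma> (u x1) < \<gamma> (u x2) \<and> \<gamma> (u x2) < \<gamma> (u x3) \<or>
      \<gamma> (u x3) < \<gamma> (u x2) \<and> \<gamma> (u x2) < \<gamma> (u x1)"
    using continuous_inj_imp_mono[OF x2(1) x3(1) continuous_on_subset[OF cont]
        inj_on_subset[OF inj]] by blast
  with x1 x2 x3 show False by (auto simp: dist_real_def e_def abs_if split: if_splits)
qed

text \<open>In the leaf space of the vertical lines the translates of the parabola-like leaf form a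
  monotone family, so the two boundary lines, which are both limits of it as the translation
  tends to the same infinity, would have to coincide.\<close>

lemma parabola_strip_not_vertical_lines:
  assumes "plane_homeo h" "maps_leaves_onto h vertical_lines F" "parabola_strip F a b"
  shows False
proof -
  obtain k where hom: "homeomorphism UNIV UNIV h k"
    using assms(1) by (auto simp: plane_homeo_def)
  have hk: "h (k p) = p" "k (h p) = p" for p
    using homeomorphism_apply1[OF hom] homeomorphism_apply2[OF hom] by simp_all
  have contk: "continuous_on S k" for S
    using hom by (meson continuous_on_subset homeomorphism_def subset_UNIV)
  \<comment> \<open>The first coordinate of \<open>k\<close> is a complete invariant of leaves, that
    is, a coordinate on the leaf space.\<close>
  have leaf: "q \<in> L \<longleftrightarrow> fst (k p) = fst (k q)" if L: "L \<in> F" "p \<in> L" for L p q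
  proof -
    obtain d where d: "L = h ` {p. fst p = d}"
      using L(1) assms(2) by (auto simp: maps_leaves_onto_def vertical_lines_def)
    have "q \<in> L \<longleftrightarrow> fst (k q) = d" for q
      unfolding d by (metis (mono_tags, lifting) hk image_iff mem_Collect_eq)
    with L(2) show ?thesis by auto
  qed
  from assms(3) obtain u where ab: "a < b" and La: "{p. fst p = a} \<in> F"
    and u: "(filterlim u at_top (at_right a) \<and> filterlim u at_top (at_left b)) \<or>
         (filterlim u at_bot (at_right a) \<and> filterlim u at_bot (at_left b))"
    and leaves: "{L \<in> F. L \<subseteq> {a<..<b} \<times> UNIV} =
      {(\<lambda>x. (x, u x + c)) ` {a<..<b} | c. True}"
    by (auto simp: parabola_strip_def)
  define Lc where "Lc c = (\<lambda>x. (x, u x + c)) ` {a<..<b}" for c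
  have LcF: "Lc c \<in> F" for c
    using leaves unfolding Lc_def by blast
  define m where "m = (a + b) / 2"
  have m: "m \<in> {a<..<b}" using ab by (simp add: m_def)
  \<comment> \<open>The leaf coordinate of the translate by \<open>c\<close>, read off above the
    midpoint \<open>m\<close>.\<close>
  define G where "G c = fst (k (m, u m + c))" for c
  have contG: "continuous_on UNIV G"
    unfolding G_def by (intro continuous_intros continuous_on_compose2[OF contk[of UNIV]]) auto
  have mLc: "(m, u m + c) \<in> Lc c" for c
    using m by (auto simp: Lc_def)
  have injG: "inj G"
  proof (rule injI)
    fix c d assume "G c = G d"
    then have "(m, u m + d) \<in> Lc c" using leaf[OF LcF mLc] by (simp add: G_def)
    then show "c = d" by (auto simp: Lc_def)
  qed
  \<comment> \<open>The point \<open>(x, 0)\<close> lies on the translate by \<open>- u x\<close>.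
    Letting \<open>x\<close> tend to \<open>a\<close> or \<open>b\<close> along the axis therefore
    runs through the translates while approaching a boundary line.\<close>
  have G: "G (- u x) = fst (k (x, 0))" if "x \<in> {a<..<b}" for x
  proof -
    have "(x, 0) \<in> Lc (- u x)" using that by (auto simp: Lc_def image_iff)
    then show ?thesis using leaf[OF LcF mLc] by (simp add: G_def)
  qed
  have lim: "((\<lambda>x. fst (k (x, 0))) \<longlongrightarrow> fst (k (z, 0))) (at z within S)" for z S
    by (intro tendsto_fst continuous_on_tendsto_compose[OF contk[of UNIV]])
      (auto intro!: tendsto_intros)
  \<comment> \<open>The line \<open>x = a\<close> is a whole leaf and misses
    \<open>(b, 0)\<close>.\<close>
  have ne: "fst (k (a, 0)) \<noteq> fst (k (b, 0))"
    using leaf[OF La, of "(a, 0)" "(b, 0)"] ab by auto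
  \<comment> \<open>The sign \<open>s\<close> reduces an infinity of either sign to
    \<open>at_top\<close>; since \<open>s * s = 1\<close>, it cancels in the leaf
    coordinate.\<close>
  have contradiction: False
    if s: "s \<in> {1, -1}" and top: "filterlim (\<lambda>x. s * u x) at_top (at_right a)"
      "filterlim (\<lambda>x. s * u x) at_top (at_left b)" for s
  proof -
    let ?\<gamma> = "\<lambda>c. G (- (s * c))"
    have \<gamma>: "?\<gamma> (s * u x) = fst (k (x, 0))" if "x \<in> {a<..<b}" for x
      using G[OF that] s by auto
    have "fst (k (a, 0)) = fst (k (b, 0))"
    proof (rule continuous_inj_limit_unique[OF _ _ top])
      show "continuous_on UNIV ?\<gamma>"
        by (intro continuous_on_compose2[OF contG] continuous_intros) auto
      show "inj ?\<gamma>"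
        using s by (auto intro!: injI dest: injD[OF injG])
      show "((\<lambda>x. ?\<gamma> (s * u x)) \<longlongrightarrow> fst (k (a, 0))) (at_right a)"
        by (rule Lim_transform_eventually[OF lim])
          (rule eventually_mono[OF eventually_at_right_real[OF ab]], simp add: \<gamma>)
      show "((\<lambda>x. ?\<gamma> (s * u x)) \<longlongrightarrow> fst (k (b, 0))) (at_left b)"
        by (rule Lim_transform_eventually[OF lim])
          (rule eventually_mono[OF eventually_at_left_real[OF ab]], simp add: \<gamma>)
    qed auto
    with ne show False by simp
  qed
  show False
    using u contradiction[of 1] contradiction[of "-1"]
    by (auto simp: filterlim_uminus_at_top)
qed

section \<open>The linear example\<close>

text \<open>The region \<open>{(P, y). \<bar>P y\<bar> < 1}\<close> is identified with the plane by \<open>P = saddle_integral (x, y)\<close>;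
  in these coordinates the metric is \<open>(1 - (P y)\<^sup>2) powr (-3) * (dP\<^sup>2 + dy\<^sup>2)\<close>, which turns out
  polynomial in \<open>x\<close> and \<open>y\<close>.\<close>

definition saddle_map :: "plane \<Rightarrow> plane" where
  "saddle_map p = (2 * fst p, snd p / 2)"

definition saddle_integral :: "plane \<Rightarrow> real" where
  "saddle_integral p = fst p / sqrt (1 + (fst p * snd p)\<^sup>2)"

definition saddle_metric :: "plane \<Rightarrow> plane \<Rightarrow> plane \<Rightarrow> real" where
  "saddle_metric p v w =
     (fst v - fst p ^ 3 * snd p * snd v) * (fst w - fst p ^ 3 * snd p * snd w) +
     (1 + (fst p * snd p)\<^sup>2) ^ 3 * (snd v * snd w)"

lemma saddle_map_power: "(saddle_map ^^ n) p = (2 ^ n * fst p, snd p / 2 ^ n)"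
  by (induction n) (auto simp: saddle_map_def)

lemma bounded_linear_saddle: "bounded_linear (\<lambda>p::plane. (a * fst p, snd p / b))"
  by (intro bounded_linear_Pair bounded_linear_const_mult bounded_linear_fst
      bounded_linear_compose[OF bounded_linear_divide bounded_linear_snd])

lemma bij_saddle_map: "bij saddle_map"
  by (rule o_bij[of "\<lambda>p. (fst p / 2, 2 * snd p)"]) (auto simp: saddle_map_def)

lemma diffeomorphism_saddle_map: "diffeomorphism saddle_map"
proof -
  have "inv saddle_map = (\<lambda>p. (fst p / 2, 2 * snd p))"
    by (rule inv_equality) (auto simp: saddle_map_def)
  moreover have "bounded_linear (\<lambda>p::plane. (fst p / 2, 2 * snd p))"
    by (intro bounded_linear_Pair bounded_linear_const_mult bounded_linear_snd
        bounded_linear_compose[OF bounded_linear_divide bounded_linear_fst])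
  moreover have "bounded_linear saddle_map"
    using bounded_linear_saddle[of 2 2] by (simp add: saddle_map_def[abs_def])
  ultimately show ?thesis
    by (simp add: diffeomorphism_def bij_saddle_map smooth_bounded_linear)
qed

lemma linear_hyperbolic_saddle_map: "linear_hyperbolic saddle_map"
  unfolding linear_hyperbolic_def
proof (intro conjI bij_saddle_map)
  show "linear saddle_map"
    using bounded_linear_saddle[of 2 2]
    by (simp add: saddle_map_def[abs_def] bounded_linear.linear)
  show "\<exists>\<alpha> v. v \<noteq> 0 \<and> saddle_map v = \<alpha> *\<^sub>R v \<and> \<bar>\<alpha>\<bar> < 1"
    by (intro exI[of _ "1/2"] exI[of _ "(0,1)"]) (auto simp: saddle_map_def zero_prod_def)
  show "\<exists>\<beta> w. w \<noteq> 0 \<and> saddle_map w = \<beta> *\<^sub>R w \<and> \<bar>\<beta>\<bar> > 1"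
    by (intro exI[of _ 2] exI[of _ "(1,0)"]) (auto simp: saddle_map_def zero_prod_def)
qed

section \<open>The metric of the linear example and its completeness\<close>

lemma saddle_radicand_pos: "0 < 1 + (x * y)\<^sup>2" for x y :: real
  by (intro add_pos_nonneg) auto

lemma riemannian_metric_saddle: "riemannian_metric saddle_metric"
  unfolding riemannian_metric_def
proof (intro conjI allI impI)
  fix p v w :: plane
  show "bilinear (saddle_metric p)"
    by (auto simp: bilinear_def linear_iff saddle_metric_def algebra_simps)
  show "saddle_metric p v w = saddle_metric p w v"
    by (simp add: saddle_metric_def mult.commute)
  show "smooth (\<lambda>p. saddle_metric p v w)"
    unfolding saddle_metric_def by (intro smooth_intros)
  assume "v \<noteq> 0"
  show "0 < saddle_metric p v v"
  proof (cases "snd v = 0")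
    case True
    then show ?thesis using \<open>v \<noteq> 0\<close>
      by (cases v) (auto simp: saddle_metric_def zero_prod_def zero_less_mult_iff)
  next
    case False
    then have "0 < snd v * snd v" by (metis not_real_square_gt_zero)
    then have "0 < (1 + (fst p * snd p)\<^sup>2) ^ 3 * (snd v * snd v)"
      by (rule mult_pos_pos[OF zero_less_power[OF saddle_radicand_pos]])
    then show ?thesis unfolding saddle_metric_def by (rule add_nonneg_pos[OF zero_le_square])
  qed
qed

text \<open>In the quotient rule the coefficient of \<open>fst v\<close> collapses, because the
  radicand minus \<open>(fst p * snd p)\<^sup>2\<close> is 1.\<close>

lemma saddle_integral_has_derivative:
  "(saddle_integral has_derivative
     (\<lambda>v. (fst v - fst p ^ 3 * snd p * snd v) / sqrt (1 + (fst p * snd p)\<^sup>2) ^ 3)) (at p)"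
proof -
  let ?R = "1 + (fst p * snd p)\<^sup>2"
  let ?w = "sqrt ?R"
  have R: "0 < ?R" by (rule saddle_radicand_pos)
  then have w: "0 < ?w" "?w\<^sup>2 = ?R" by auto
  have "((\<lambda>p. sqrt (1 + (fst p * snd p)\<^sup>2)) has_derivative
     (\<lambda>v. (fst p * snd p) * (fst p * snd v + fst v * snd p) / ?w)) (at p)"
    using R by (auto intro!: derivative_eq_intros
        simp: fun_eq_iff divide_simps power2_eq_square algebra_simps)
  from has_derivative_divide'[OF bounded_linear_imp_has_derivative[OF bounded_linear_fst] this]
  have "(saddle_integral has_derivative
     (\<lambda>v. (fst v * ?w - fst p * ((fst p * snd p) * (fst p * snd v + fst v * snd p) / ?w)) /
       ?w\<^sup>2)) (at p)"
    using w unfolding saddle_integral_def[abs_def] power2_eq_square[of ?w] by simp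
  moreover have "(fst v * ?w - fst p * ((fst p * snd p) * (fst p * snd v + fst v * snd p) / ?w)) /
      ?w\<^sup>2 = (fst v - fst p ^ 3 * snd p * snd v) / ?w ^ 3" for v
  proof -
    have "(fst v * ?w - fst p * ((fst p * snd p) * (fst p * snd v + fst v * snd p) / ?w)) / ?w\<^sup>2
      = (fst v * ?w\<^sup>2 - fst p * ((fst p * snd p) * (fst p * snd v + fst v * snd p))) / ?w ^ 3"
      using w(1) by (simp add: divide_simps power2_eq_square power3_eq_cube)
    also have "fst v * ?w\<^sup>2 - fst p * ((fst p * snd p) * (fst p * snd v + fst v * snd p)) =
        fst v - fst p ^ 3 * snd p * snd v"
      unfolding w(2) by (simp add: power2_eq_square power3_eq_cube algebra_simps)
    finally show ?thesis .
  qed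
  ultimately show ?thesis by simp
qed

lemma saddle_integral_saddle_map: "saddle_integral (saddle_map p) = 2 * saddle_integral p"
  by (simp add: saddle_integral_def saddle_map_def)

text \<open>Written as a hypotenuse, the norm visibly bounds each of its two legs.\<close>

lemma riem_norm_saddle_metric:
  "riem_norm saddle_metric p v =
     sqrt ((fst v - fst p ^ 3 * snd p * snd v)\<^sup>2 + (sqrt (1 + (fst p * snd p)\<^sup>2) ^ 3 * snd v)\<^sup>2)"
proof -
  let ?R = "1 + (fst p * snd p)\<^sup>2"
  have "(sqrt ?R ^ 3 * snd v)\<^sup>2 = (sqrt ?R ^ 2) ^ 3 * (snd v)\<^sup>2"
    by (simp only: power_mult_distrib power_mult[symmetric] mult.commute)
  also have "sqrt ?R ^ 2 = ?R" using saddle_radicand_pos[of "fst p" "snd p"] by simp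
  finally show ?thesis
    unfolding riem_norm_def saddle_metric_def by (simp only: power2_eq_square)
qed

text \<open>Three confinements in a row: \<open>saddle_integral\<close> and \<open>snd\<close> are
  globally Lipschitz for the metric, and where both are bounded the product \<open>x y\<close> is
  Lipschitz too. Then \<open>x\<close> is bounded as well, and the metric dominates the Euclidean
  one.\<close>

lemma riem_complete_saddle: "riem_complete saddle_metric"
proof (rule riem_completeI[OF riemannian_metric_saddle])
  fix \<sigma> assume Cau: "riem_Cauchy saddle_metric \<sigma>"
  let ?N = "riem_norm saddle_metric"
  define w where "w z = sqrt (1 + (fst z * snd z)\<^sup>2)" for z :: plane
  \<comment> \<open>With \<open>P\<close> for \<open>saddle_integral\<close>, \<open>U z v\<close>
    is \<open>w z ^ 3\<close> times the derivative of \<open>P\<close> in the direction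
    \<open>v\<close>.\<close>
  define U where "U z v = fst v - fst z ^ 3 * snd z * snd v" for z v :: plane
  have w1: "1 \<le> w z" for z by (simp add: w_def)
  have w2: "(w z)\<^sup>2 = 1 + (fst z * snd z)\<^sup>2" for z
    using saddle_radicand_pos[of "fst z" "snd z"] by (simp add: w_def)
  have w3: "1 \<le> w z ^ 3" for z using w1 by simp
  have N0: "0 \<le> ?N z v" for z v by (rule riem_norm_nonneg[OF riemannian_metric_saddle])
  have U: "\<bar>U z v\<bar> \<le> ?N z v" for z v
    unfolding riem_norm_saddle_metric U_def by (rule real_sqrt_ge_abs1)
  have V: "w z ^ 3 * \<bar>snd v\<bar> \<le> ?N z v" for z v
  proof -
    have "\<bar>w z ^ 3 * snd v\<bar> \<le> ?N z v"
      unfolding riem_norm_saddle_metric w_def by (rule real_sqrt_ge_abs2)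
    then show ?thesis using w3[of z] by (simp add: abs_mult)
  qed
  have V1: "\<bar>snd v\<bar> \<le> ?N z v" for z v
    using mult_right_mono[OF w3[of z], of "\<bar>snd v\<bar>"] V[of z v] by simp
  have dP: "norm (U z v / w z ^ 3) \<le> 1 * ?N z v" for z v
  proof -
    have "\<bar>U z v\<bar> / w z ^ 3 \<le> \<bar>U z v\<bar> / 1"
      using w1[of z] w3[of z] by (intro divide_left_mono) auto
    moreover have "\<bar>w z ^ 3\<bar> = w z ^ 3" using w3[of z] by linarith
    ultimately show ?thesis using U[of z v] by (simp add: abs_divide del: power_abs)
  qed
  from short_paths_in_bounded[OF riemannian_metric_saddle Cau short_paths_in_UNIV
      saddle_integral_has_derivative dP[unfolded U_def w_def] zero_le_one]
  obtain R1 where R1: "0 \<le> R1"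
    and sh1: "short_paths_in saddle_metric \<sigma> (UNIV \<inter> {z. norm (saddle_integral z) \<le> R1})" .
  have dy: "norm (snd v) \<le> 1 * ?N z v" for z v using V1 by simp
  from short_paths_in_bounded[OF riemannian_metric_saddle Cau sh1
      bounded_linear_imp_has_derivative[OF bounded_linear_snd] dy zero_le_one]
  obtain R2 where R2: "0 \<le> R2"
    and sh2: "short_paths_in saddle_metric \<sigma>
      (UNIV \<inter> {z. norm (saddle_integral z) \<le> R1} \<inter> {z. norm (snd z) \<le> R2})" .
  have fst_eq: "fst z = saddle_integral z * w z" for z
    using w1[of z] saddle_radicand_pos[of "fst z" "snd z"]
    by (simp add: saddle_integral_def w_def less_imp_neq[symmetric])
  \<comment> \<open>Since \<open>(P y)\<^sup>2 = (x y)\<^sup>2 / (1 + (x y)\<^sup>2)\<close>, a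
    bound on \<open>x y\<close> keeps the paths away from the boundary of the region
    \<open>\<bar>P y\<bar> < 1\<close>.\<close>
  let ?T = "\<lambda>z::plane. fst z * snd z"
  have "(?T has_derivative (\<lambda>v. fst z * snd v + fst v * snd z)) (at z)" for z
    by (auto intro!: derivative_eq_intros)
  note dT = this
  have dT_le: "norm (fst z * snd v + fst v * snd z) \<le> (R1 + R2) * ?N z v"
    if "z \<in> UNIV \<inter> {z. norm (saddle_integral z) \<le> R1} \<inter> {z. norm (snd z) \<le> R2}" for z v
  proof -
    \<comment> \<open>The differential of \<open>x y\<close> is rearranged into the two legs of the
      norm: \<open>x * (1 + (x y)\<^sup>2)\<close> equals \<open>P * w ^ 3\<close>, so the
      multipliers are the bounded quantities \<open>y\<close> and \<open>P\<close>.\<close>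
    have "fst z * snd v + fst v * snd z = snd z * U z v + fst z * (1 + (fst z * snd z)\<^sup>2) * snd v"
      by (simp add: U_def power2_eq_square power3_eq_cube algebra_simps)
    also have "\<dots> = snd z * U z v + saddle_integral z * (w z ^ 3 * snd v)"
      unfolding w2[symmetric] using fst_eq[of z]
      by (simp add: power2_eq_square power3_eq_cube)
    finally have "norm (fst z * snd v + fst v * snd z) \<le>
        \<bar>snd z * U z v\<bar> + \<bar>saddle_integral z * (w z ^ 3 * snd v)\<bar>"
      by (metis abs_triangle_ineq real_norm_def)
    also have "\<dots> = \<bar>snd z\<bar> * \<bar>U z v\<bar> + \<bar>saddle_integral z\<bar> * (w z ^ 3 * \<bar>snd v\<bar>)"
      using w1[of z] by (simp add: abs_mult)
    also have "\<dots> \<le> R2 * ?N z v + R1 * ?N z v"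
      using that w1[of z] R1 R2 U[of z v] V[of z v]
      by (intro add_mono mult_mono mult_nonneg_nonneg zero_le_power) auto
    finally show ?thesis by (simp add: algebra_simps)
  qed
  from short_paths_in_bounded[OF riemannian_metric_saddle Cau sh2 dT dT_le
      add_nonneg_nonneg[OF R1 R2]]
  obtain R3 where R3: "0 \<le> R3"
    and sh3: "short_paths_in saddle_metric \<sigma>
      (UNIV \<inter> {z. norm (saddle_integral z) \<le> R1} \<inter> {z. norm (snd z) \<le> R2} \<inter>
       {z. norm (?T z) \<le> R3})" (is "short_paths_in _ _ ?S") .
  \<comment> \<open>A bound for \<open>\<bar>x\<bar>\<close>, from \<open>x = P * w\<close>.\<close>
  let ?X = "R1 * sqrt (1 + R3\<^sup>2)"
  have "norm v \<le> (?X ^ 3 * R2 + 2) * ?N z v" if z: "z \<in> ?S" for z v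
  proof -
    have "(?T z)\<^sup>2 \<le> R3\<^sup>2" using z R3 by (intro abs_le_square_iff[THEN iffD1]) auto
    then have "w z \<le> sqrt (1 + R3\<^sup>2)" by (simp add: w_def)
    then have "\<bar>fst z\<bar> \<le> ?X"
      unfolding fst_eq[of z] abs_mult using z w1[of z] R1 by (intro mult_mono) auto
    then have X: "\<bar>fst z\<bar> ^ 3 * \<bar>snd z\<bar> \<le> ?X ^ 3 * R2"
      using z R1 R2 by (intro mult_mono power_mono) auto
    have "fst v = U z v + fst z ^ 3 * snd z * snd v" by (simp add: U_def)
    then have "\<bar>fst v\<bar> \<le> \<bar>U z v\<bar> + \<bar>fst z\<bar> ^ 3 * \<bar>snd z\<bar> * \<bar>snd v\<bar>"
      using abs_triangle_ineq[of "U z v" "fst z ^ 3 * snd z * snd v"]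
      by (simp add: abs_mult power_abs)
    also have "\<dots> \<le> ?N z v + ?X ^ 3 * R2 * ?N z v"
      using R1 R2 by (intro add_mono[OF U mult_mono[OF X V1]]) auto
    finally have "\<bar>fst v\<bar> + \<bar>snd v\<bar> \<le> (?X ^ 3 * R2 + 2) * ?N z v"
      using V1[of v z] by (simp add: algebra_simps)
    moreover have "norm v \<le> \<bar>fst v\<bar> + \<bar>snd v\<bar>"
      using norm_Pair_le[of "fst v" "snd v"] by simp
    ultimately show ?thesis by linarith
  qed
  with sh3 show "\<exists>S M. short_paths_in saddle_metric \<sigma> S \<and> (\<forall>z\<in>S. \<forall>v. norm v \<le> M * ?N z v)"
    by blast
qed

text \<open>The leaf of value \<open>c\<close> is \<open>x = c / sqrt (1 - c\<^sup>2 y\<^sup>2)\<close>, \<open>\<bar>y\<bar> < 1 / \<bar>c\<bar>\<close>; the first component below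
  is a parameter which runs over the whole real line along each leaf.\<close>

lemma saddle_chart:
  "homeomorphism UNIV UNIV
     (\<lambda>p. (snd p * sqrt (1 + (fst p * snd p)\<^sup>2), saddle_integral p))
     (\<lambda>z. (snd z * sqrt (1 + (snd z * fst z)\<^sup>2), fst z / sqrt (1 + (snd z * fst z)\<^sup>2)))"
    (is "homeomorphism _ _ ?\<phi> ?\<psi>")
proof (rule homeomorphismI)
  have ne: "sqrt (1 + (x * y)\<^sup>2) \<noteq> 0" for x y :: real
    using saddle_radicand_pos[of x y] by auto
  then show "continuous_on UNIV ?\<phi>" "continuous_on UNIV ?\<psi>"
    unfolding saddle_integral_def by (auto intro!: continuous_intros)
  show "?\<psi> (?\<phi> p) = p" for p
  proof -
    \<comment> \<open>The two chart coordinates have the same product as \<open>x\<close> and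
      \<open>y\<close>, so the same square root occurs in both directions and cancels.\<close>
    have "saddle_integral p * (snd p * sqrt (1 + (fst p * snd p)\<^sup>2)) = fst p * snd p"
      using ne[of "fst p" "snd p"] by (simp add: saddle_integral_def)
    then show ?thesis
      using ne[of "fst p" "snd p"] by (simp add: saddle_integral_def)
  qed
  show "?\<phi> (?\<psi> z) = z" for z
  proof -
    let ?s = "sqrt (1 + (snd z * fst z)\<^sup>2)"
    have "(snd z * ?s) * (fst z / ?s) = snd z * fst z"
      using ne[of "snd z" "fst z"] by simp
    then show ?thesis
      using ne[of "snd z" "fst z"] by (simp add: saddle_integral_def)
  qed
qed auto

lemma foliation_saddle_integral: "foliation (level_sets saddle_integral)"
  using foliation_level_sets[OF saddle_chart] by simp

text \<open>Each leaf is a slice of the inverse chart at a fixed second coordinate; the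
  parametrization is regular because its second component has positive derivative.\<close>

lemma C1_leaves_saddle_integral: "C1_leaves (level_sets saddle_integral)"
  unfolding C1_leaves_def
proof
  fix L assume "L \<in> level_sets saddle_integral"
  then obtain c where L: "L = {p. saddle_integral p = c}" by (auto simp: level_sets_def)
  let ?w = "\<lambda>t. sqrt (1 + (c * t)\<^sup>2)"
  let ?\<psi> = "\<lambda>z::plane. (snd z * sqrt (1 + (snd z * fst z)\<^sup>2), fst z / sqrt (1 + (snd z * fst z)\<^sup>2))"
  let ?\<gamma> = "\<lambda>t. (c * ?w t, t / ?w t)"
  let ?\<gamma>' = "\<lambda>t. (c ^ 3 * t / ?w t, 1 / ?w t ^ 3)"
  have w: "0 < ?w t" "(?w t)\<^sup>2 = 1 + (c * t)\<^sup>2" for t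
    using saddle_radicand_pos[of c t] by auto
  have \<gamma>: "?\<gamma> t = ?\<psi> (t, c)" for t by simp
  have "inj ?\<gamma>"
    unfolding \<gamma> by (rule injI) (metis homeomorphism_apply2[OF saddle_chart] UNIV_I fst_conv)
  moreover have "range ?\<gamma> = L"
  proof (intro set_eqI iffI)
    fix p assume "p \<in> range ?\<gamma>"
    then obtain t where "p = ?\<psi> (t, c)" by auto
    then have "saddle_integral p = c"
      using homeomorphism_apply2[OF saddle_chart, of "(t, c)"] by simp
    then show "p \<in> L" by (simp add: L)
  next
    fix p assume "p \<in> L"
    then have "p = ?\<psi> (snd p * sqrt (1 + (fst p * snd p)\<^sup>2), c)"
      using homeomorphism_apply1[OF saddle_chart, of p] by (simp add: L)
    then show "p \<in> range ?\<gamma>" unfolding \<gamma> by (rule range_eqI)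
  qed
  moreover have "(?\<gamma> has_vector_derivative ?\<gamma>' t) (at t)" for t
  proof (rule has_vector_derivative_Pair)
    have "((\<lambda>t. ?w t) has_real_derivative c * (c * t) / ?w t) (at t)"
      using saddle_radicand_pos[of c t]
      by (auto intro!: derivative_eq_intros simp: field_simps power2_eq_square)
    note dw = this
    show "((\<lambda>t. c * ?w t) has_vector_derivative c ^ 3 * t / ?w t) (at t)"
      using DERIV_cmult[OF dw, of c]
      by (simp add: has_real_derivative_iff_has_vector_derivative[symmetric] power3_eq_cube mult.assoc)
    have "((\<lambda>t. t / ?w t) has_real_derivative (1 * ?w t - t * (c * (c * t) / ?w t)) / (?w t * ?w t)) (at t)"
      by (rule DERIV_divide[OF DERIV_ident dw]) (use w(1)[of t] in linarith)
    moreover have "(1 * ?w t - t * (c * (c * t) / ?w t)) / (?w t * ?w t) = 1 / ?w t ^ 3"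
    proof -
      have "(1 * ?w t - t * (c * (c * t) / ?w t)) / (?w t * ?w t) =
          ((?w t)\<^sup>2 - (c * t)\<^sup>2) / ?w t ^ 3"
        using w(1)[of t] by (simp add: divide_simps power2_eq_square power3_eq_cube)
      then show ?thesis unfolding w(2) by simp
    qed
    ultimately show "((\<lambda>t. t / ?w t) has_vector_derivative 1 / ?w t ^ 3) (at t)"
      by (simp add: has_real_derivative_iff_has_vector_derivative)
  qed
  moreover have "continuous_on UNIV ?\<gamma>'"
  proof -
    have "1 + (c * t)\<^sup>2 \<noteq> 0" for t using saddle_radicand_pos[of c t] by linarith
    then show ?thesis by (intro continuous_intros) auto
  qed
  moreover have "?\<gamma>' t \<noteq> 0" for t
    using w(1)[of t] by (simp add: zero_prod_def)
  ultimately have "C1_parametrization ?\<gamma> ?\<gamma>' L" by (simp add: C1_parametrization_def)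
  then show "\<exists>\<gamma> \<gamma>'. C1_parametrization \<gamma> \<gamma>' L" by blast
qed

text \<open>The product \<open>x y\<close> is invariant under the map. On horizontal lines only
  \<open>dx\<close> survives, and it doubles. On the level sets of \<open>saddle_integral\<close>
  the first square in the metric vanishes, and in the second \<open>dy\<close> is halved while its
  coefficient is invariant.\<close>

lemma anosov_structure_saddle:
  "anosov_structure saddle_map saddle_metric (level_sets saddle_integral) horizontal_lines"
proof (rule anosov_structureI[where D = "\<lambda>n p v. (2 ^ n * fst v, snd v / 2 ^ n)" and \<Lambda> = 2])
  show "leaf_invariant saddle_map (level_sets saddle_integral)"
    by (rule leaf_invariant_level_sets[OF bij_saddle_map, of 2 _ 0])
      (auto simp: saddle_integral_saddle_map)
  show "leaf_invariant saddle_map horizontal_lines"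
    unfolding horizontal_lines_eq_level_sets
    by (rule leaf_invariant_level_sets[OF bij_saddle_map, of "1/2" _ 0])
      (auto simp: saddle_map_def)
  show "((saddle_map ^^ n) has_derivative (\<lambda>v. (2 ^ n * fst v, snd v / 2 ^ n))) (at p)" for n p
    unfolding saddle_map_power[abs_def]
    by (rule bounded_linear_imp_has_derivative[OF bounded_linear_saddle])
next
  fix n p v assume "tangent_to_leaf horizontal_lines p v"
  then have "snd v = 0" by (rule tangent_to_horizontal_line)
  then show "saddle_metric ((saddle_map ^^ n) p) (2 ^ n * fst v, snd v / 2 ^ n)
      (2 ^ n * fst v, snd v / 2 ^ n) = (2 ^ n)\<^sup>2 * saddle_metric p v v"
    by (simp add: saddle_metric_def saddle_map_power power2_eq_square)
next
  fix n p v assume "tangent_to_leaf (level_sets saddle_integral) p v"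
  from tangent_to_level_set[OF this saddle_integral_has_derivative]
  have v: "fst v = fst p ^ 3 * snd p * snd v"
    using saddle_radicand_pos[of "fst p" "snd p"] by auto
  \<comment> \<open>The form \<open>dx - x^3 y dy\<close> is multiplied by \<open>2 ^ n\<close>, so
    its vanishing persists under iteration.\<close>
  then have "2 ^ n * fst v - (2 ^ n * fst p) ^ 3 * (snd p / 2 ^ n) * (snd v / 2 ^ n) = 0"
    by (simp add: power3_eq_cube)
  with v show "saddle_metric ((saddle_map ^^ n) p) (2 ^ n * fst v, snd v / 2 ^ n)
      (2 ^ n * fst v, snd v / 2 ^ n) = (inverse (2 ^ n))\<^sup>2 * saddle_metric p v v"
    by (simp add: saddle_metric_def saddle_map_power power2_eq_square inverse_eq_divide)
qed (simp_all add: diffeomorphism_saddle_map riemannian_metric_saddle riem_complete_saddle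
    foliation_saddle_integral C1_leaves_saddle_integral foliation_horizontal_lines
    C1_leaves_horizontal_lines)

text \<open>Every vertical line meets every horizontal line, whereas the leaves \<open>P = 1\<close>
  and \<open>y = 1\<close> could meet only on the excluded boundary \<open>P y = 1\<close>; at such
  a point \<open>x = sqrt (1 + x\<^sup>2)\<close>.\<close>

lemma no_product_structure_saddle:
  assumes "plane_homeo h" "maps_leaves_onto h (level_sets saddle_integral) vertical_lines"
    "maps_leaves_onto h horizontal_lines horizontal_lines"
  shows False
proof -
  let ?A = "{p. saddle_integral p = 1}" and ?B = "{p::plane. snd p = 1}"
  have disj: "?A \<inter> ?B = {}"
  proof -
    have "x < sqrt (1 + x\<^sup>2)" for x :: real by (rule real_less_rsqrt) simp
    then have "sqrt (1 + x\<^sup>2) \<noteq> x" for x :: real by (metis less_irrefl)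
    then show ?thesis by (auto simp: saddle_integral_def)
  qed
  have "?A \<in> level_sets saddle_integral" "?B \<in> horizontal_lines"
    by (auto simp: level_sets_def horizontal_lines_def)
  then have "h ` ?A \<in> vertical_lines" "h ` ?B \<in> horizontal_lines"
    using assms(2,3) unfolding maps_leaves_onto_def by blast+
  then obtain c d where "h ` ?A = {p. fst p = c}" "h ` ?B = {p. snd p = d}"
    unfolding vertical_lines_def horizontal_lines_def by blast
  then have "(c, d) \<in> h ` ?A \<inter> h ` ?B" by simp
  moreover have "inj h"
    using assms(1) unfolding plane_homeo_def by (metis UNIV_I homeomorphism_apply1 injI)
  ultimately have "(c, d) \<in> h ` (?A \<inter> ?B)" by (simp only: image_Int)
  with disj show False by simp
qed

section \<open>The translation example\<close>

text \<open>With \<open>x = exp u\<close>, \<open>y = exp v\<close> the metric is \<open>(1 + 1 / (x y)\<^sup>2) * (dx\<^sup>2 + dy\<^sup>2)\<close>.\<close>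

definition shift_map :: "plane \<Rightarrow> plane" where
  "shift_map p = (fst p + 1, snd p - 1)"

definition shift_metric :: "plane \<Rightarrow> plane \<Rightarrow> plane \<Rightarrow> real" where
  "shift_metric p v w =
     ((exp (fst p))\<^sup>2 + (exp (- snd p))\<^sup>2) * (fst v * fst w) +
     ((exp (snd p))\<^sup>2 + (exp (- fst p))\<^sup>2) * (snd v * snd w)"

lemma shift_map_power: "(shift_map ^^ n) p = (fst p + real n, snd p - real n)"
  by (induction n) (auto simp: shift_map_def)

lemma smooth_translation: "smooth (\<lambda>p::plane. (fst p + a, snd p + b))"
  using smooth_add[OF smooth_bounded_linear[OF bounded_linear_ident] smooth_const[of "(a, b)"]]
  by (simp add: plus_prod_def)

lemma bij_shift_map: "bij shift_map"
  by (rule o_bij[of "\<lambda>p. (fst p - 1, snd p + 1)"]) (auto simp: shift_map_def)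

lemma diffeomorphism_shift_map: "diffeomorphism shift_map"
proof -
  have "inv shift_map = (\<lambda>p. (fst p - 1, snd p + 1))"
    by (rule inv_equality) (auto simp: shift_map_def)
  then show ?thesis
    using smooth_translation[of 1 "-1"] smooth_translation[of "-1" 1]
    by (simp add: diffeomorphism_def bij_shift_map[unfolded shift_map_def[abs_def]]
        shift_map_def[abs_def])
qed

text \<open>The sum of the coordinates is invariant; a shear makes it the second coordinate and
  leaves the first to be shifted by 1.\<close>

lemma shift_map_conjugate: "topologically_conjugate shift_map (\<lambda>(x, y). (x + 1, y))"
proof -
  have "homeomorphism UNIV UNIV (\<lambda>p::plane. (fst p, fst p + snd p)) (\<lambda>p. (fst p, snd p - fst p))"
    by (rule homeomorphismI) (auto intro!: continuous_intros)
  then have "plane_homeo (\<lambda>p. (fst p, fst p + snd p))"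
    unfolding plane_homeo_def by blast
  then show ?thesis
    unfolding topologically_conjugate_def
    by (intro exI[of _ "\<lambda>p. (fst p, fst p + snd p)"]) (auto simp: shift_map_def)
qed

section \<open>The metric of the translation example and its completeness\<close>

lemma riemannian_metric_shift: "riemannian_metric shift_metric"
  unfolding riemannian_metric_def
proof (intro conjI allI impI)
  fix p v w :: plane
  show "bilinear (shift_metric p)"
    by (auto simp: bilinear_def linear_iff shift_metric_def algebra_simps)
  show "shift_metric p v w = shift_metric p w v"
    by (simp add: shift_metric_def mult.commute)
  show "smooth (\<lambda>p. shift_metric p v w)"
    unfolding shift_metric_def by (intro smooth_intros)
  assume "v \<noteq> 0"
  have pos: "0 < (exp a)\<^sup>2 + (exp b)\<^sup>2" for a b :: real
    by (intro add_pos_pos) auto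
  have nonneg: "0 \<le> ((exp a)\<^sup>2 + (exp b)\<^sup>2) * (t * t)" for a b t :: real
    by (intro mult_nonneg_nonneg less_imp_le[OF pos] zero_le_square)
  have pos': "0 < ((exp a)\<^sup>2 + (exp b)\<^sup>2) * (t * t)" if "t \<noteq> 0" for a b t :: real
    using that by (intro mult_pos_pos[OF pos]) (metis not_real_square_gt_zero)
  have "fst v \<noteq> 0 \<or> snd v \<noteq> 0" using \<open>v \<noteq> 0\<close> by (cases v) (auto simp: zero_prod_def)
  then show "0 < shift_metric p v v"
    unfolding shift_metric_def using pos' nonneg by (metis add_nonneg_pos add_pos_nonneg)
qed

text \<open>The functions \<open>exp (fst p)\<close> and \<open>exp (snd p)\<close> are Lipschitz by
  the first summands of the two coefficients, so they stay bounded on short paths. The reciprocals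
  in the second summands are then bounded below, and the metric dominates the Euclidean one.\<close>

lemma riem_complete_shift: "riem_complete shift_metric"
proof (rule riem_completeI[OF riemannian_metric_shift])
  fix \<sigma> assume Cau: "riem_Cauchy shift_metric \<sigma>"
  let ?N = "riem_norm shift_metric"
  \<comment> \<open>The four pairs are the four squares into which \<open>shift_metric z v v\<close>
    expands.\<close>
  have bound: "\<bar>exp a * t\<bar> \<le> ?N z v"
    if "(a, t) \<in> {(fst z, fst v), (- snd z, fst v), (snd z, snd v), (- fst z, snd v)}" for a t z v
  proof -
    have "(exp a * t)\<^sup>2 \<le> shift_metric z v v"
      using that
      by (auto simp: shift_metric_def power2_eq_square[symmetric] power_mult_distrib distrib_right)
    then show ?thesis
      unfolding riem_norm_def by (metis real_sqrt_abs real_sqrt_le_mono)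
  qed
  have "((\<lambda>p. exp (fst p)) has_derivative (\<lambda>v. exp (fst z) * fst v)) (at z)" for z :: plane
    by (auto intro!: derivative_eq_intros)
  note d1 = this
  have le1: "norm (exp (fst z) * fst v) \<le> 1 * ?N z v" for z v
    using bound[of "fst z" "fst v"] by simp
  from short_paths_in_bounded[OF riemannian_metric_shift Cau short_paths_in_UNIV d1 le1 zero_le_one]
  obtain R1 where R1: "0 \<le> R1"
    and sh1: "short_paths_in shift_metric \<sigma> (UNIV \<inter> {z. norm (exp (fst z)) \<le> R1})" .
  have "((\<lambda>p. exp (snd p)) has_derivative (\<lambda>v. exp (snd z) * snd v)) (at z)" for z :: plane
    by (auto intro!: derivative_eq_intros)
  note d2 = this
  have le2: "norm (exp (snd z) * snd v) \<le> 1 * ?N z v" for z v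
    using bound[of "snd z" "snd v"] by simp
  from short_paths_in_bounded[OF riemannian_metric_shift Cau sh1 d2 le2 zero_le_one]
  obtain R2 where R2: "0 \<le> R2"
    and sh2: "short_paths_in shift_metric \<sigma>
      (UNIV \<inter> {z. norm (exp (fst z)) \<le> R1} \<inter> {z. norm (exp (snd z)) \<le> R2})"
      (is "short_paths_in _ _ ?S") .
  have "norm v \<le> (R1 + R2) * ?N z v" if z: "z \<in> ?S" for z v
  proof -
    have "\<bar>fst v\<bar> = exp (snd z) * \<bar>exp (- snd z) * fst v\<bar>"
      by (simp add: abs_mult exp_minus)
    also have "\<dots> \<le> R2 * ?N z v"
      using z R2 bound[of "- snd z" "fst v" z v] by (intro mult_mono) auto
    finally have 1: "\<bar>fst v\<bar> \<le> R2 * ?N z v" .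
    have "\<bar>snd v\<bar> = exp (fst z) * \<bar>exp (- fst z) * snd v\<bar>"
      by (simp add: abs_mult exp_minus)
    also have "\<dots> \<le> R1 * ?N z v"
      using z R1 bound[of "- fst z" "snd v" z v] by (intro mult_mono) auto
    finally have "\<bar>fst v\<bar> + \<bar>snd v\<bar> \<le> (R1 + R2) * ?N z v"
      using 1 by (simp add: algebra_simps)
    moreover have "norm v \<le> \<bar>fst v\<bar> + \<bar>snd v\<bar>"
      using norm_Pair_le[of "fst v" "snd v"] by simp
    ultimately show ?thesis by linarith
  qed
  with sh2 show "\<exists>S M. short_paths_in shift_metric \<sigma> S \<and> (\<forall>z\<in>S. \<forall>v. norm v \<le> M * ?N z v)"
    by blast
qed

text \<open>The iterates are translations and leave vectors unchanged, so the rates come from the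
  coefficients alone: both summands of the first grow by \<open>(exp 1 ^ n)\<^sup>2\<close>, and
  both of the second shrink by it.\<close>

lemma anosov_structure_shift:
  "anosov_structure shift_map shift_metric vertical_lines horizontal_lines"
proof (rule anosov_structureI[where D = "\<lambda>n p v. v" and \<Lambda> = "exp 1"])
  show "leaf_invariant shift_map vertical_lines"
    unfolding vertical_lines_eq_level_sets
    by (rule leaf_invariant_level_sets[OF bij_shift_map, of 1 _ 1]) (auto simp: shift_map_def)
  show "leaf_invariant shift_map horizontal_lines"
    unfolding horizontal_lines_eq_level_sets
    by (rule leaf_invariant_level_sets[OF bij_shift_map, of 1 _ "-1"]) (auto simp: shift_map_def)
  show "((shift_map ^^ n) has_derivative (\<lambda>v. v)) (at p)" for n p
  proof -
    have "shift_map ^^ n = (\<lambda>p. p + (real n, - real n))"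
      by (rule ext) (simp add: shift_map_power plus_prod_def)
    then show ?thesis by (auto intro!: derivative_eq_intros)
  qed
next
  fix n p v assume "tangent_to_leaf horizontal_lines p v"
  then have "snd v = 0" by (rule tangent_to_horizontal_line)
  then show "shift_metric ((shift_map ^^ n) p) v v = (exp 1 ^ n)\<^sup>2 * shift_metric p v v"
    by (simp add: shift_metric_def shift_map_power exp_of_nat_mult[symmetric] exp_add exp_diff
        exp_minus power_mult_distrib power_divide field_simps)
next
  fix n p v assume "tangent_to_leaf vertical_lines p v"
  then have "fst v = 0" by (rule tangent_to_vertical_line)
  then show "shift_metric ((shift_map ^^ n) p) v v = (inverse (exp 1 ^ n))\<^sup>2 * shift_metric p v v"
    by (simp add: shift_metric_def shift_map_power exp_of_nat_mult[symmetric] exp_add exp_diff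
        exp_minus power_mult_distrib power_divide field_simps)
qed (simp_all add: diffeomorphism_shift_map riemannian_metric_shift riem_complete_shift
    foliation_vertical_lines C1_leaves_vertical_lines foliation_horizontal_lines
    C1_leaves_horizontal_lines)

theorem mainTheorem1:
  shows
    "(\<exists>f g Fs Fu. anosov_structure f g Fs Fu \<and> linear_hyperbolic f \<and>
        \<not> (\<exists>h. plane_homeo h \<and> maps_leaves_onto h Fs vertical_lines \<and>
              maps_leaves_onto h Fu horizontal_lines))
     \<and>
     (\<exists>f g Fs Fu. anosov_structure f g Fs Fu \<and>
        topologically_conjugate f (\<lambda>(x, y). (x + 1, y)) \<and>
        (\<forall>e_s e_u. white_frame e_s e_u \<longrightarrow>
           \<not> (\<exists>h. plane_homeo h \<and> maps_leaves_onto h Fs (integral_leaves e_s))))"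
proof (rule conjI)
  show "\<exists>f g Fs Fu. anosov_structure f g Fs Fu \<and> linear_hyperbolic f \<and>
        \<not> (\<exists>h. plane_homeo h \<and> maps_leaves_onto h Fs vertical_lines \<and>
              maps_leaves_onto h Fu horizontal_lines)"
    using anosov_structure_saddle linear_hyperbolic_saddle_map no_product_structure_saddle by blast
  have "\<not> (\<exists>h. plane_homeo h \<and> maps_leaves_onto h vertical_lines (integral_leaves e_s))"
    if "white_frame e_s e_u" for e_s e_u
    using that parabola_strip_not_vertical_lines unfolding white_frame_def by blast
  then show "\<exists>f g Fs Fu. anosov_structure f g Fs Fu \<and>
        topologically_conjugate f (\<lambda>(x, y). (x + 1, y)) \<and>
        (\<forall>e_s e_u. white_frame e_s e_u \<longrightarrow>
           \<not> (\<exists>h. plane_homeo h \<and> maps_leaves_onto h Fs (integral_leaves e_s)))"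
    using anosov_structure_shift shift_map_conjugate by blast
qed

end
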